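(* Let $f$ and $g$ be general position maps of the vertex set $\langle N\rangle=\{0,1,\dots,N\}$ of $S$ into $\mathbb{R}^m$ and let $k\in\langle N\rangle$. Assume further that $f(i)=g(i)$ for all $i\in\langle k\rangle=\{0,\dots,k\}$ and that the set $\{f(0),\dots,f(N),g(k+1),\dots,g(N)\}$ is in general position. For every subset $J\subset\langle N\rangle$ with $|J|=m+1$ denote by $\varepsilon_g(J)$ the orientation of the simplex $g(J)$. Then the deformation cochain $\lambda_{f,g}\in C^{m-1}(S^2_\Delta)$ has the following properties for every such $J$: $$\sum_{\tau_+\times\tau_-\in\mathcal{P}_J}|\lambda_{f,g}(\tau_+\times\tau_-)|\ \le\ m-\ell_J^k,$$ $$-1\ \le\ \varepsilon_g(J)\sum_{\tau_+\times\tau_-\in\mathcal{P}_J}\operatorname{sgn}(\tau_+,\tau_-)\,\lambda_{f,g}(\tau_+\times\tau_-)\ \le\ 0,$$ and $$-\left\lceil\frac{m-\ell_J^k}{2}\right\rceil\ \le\ \varepsilon_g(J)\operatorname{sgn}(\tau_+,\tau_-)\,\lambda_{f,g}(\tau_+\times\tau_-)\ \le\ \left\lfloor\frac{m-\ell_J^k}{2}\right\rfloor$$ for every $\tau_+\times\tau_-\in\mathcal{P}_J$.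
   Context: A map $f:\langle N\rangle\to\mathbb{R}^m$ is a general position map if any $m+1$ points of $\langle N\rangle$ are mapped to affinely independent points of $\mathbb{R}^m$; a set of points in $\mathbb{R}^m$ is in general position if any $m+1$ of its points are affinely independent. $S$ denotes the $m$-skeleton of the simplex with vertex set $\langle N\rangle$; its simplices are oriented by the increasing order of their vertices, and $|S|$ is its geometric realization. The deleted product $S^2_\Delta$ is the complex of all cells $\sigma_1\times\sigma_2$ with $\sigma_1,\sigma_2$ disjoint simplices of $S$; such a cell has dimension $\dim\sigma_1+\dim\sigma_2$. $C^{m-1}(S^2_\Delta)$ is its group of integral $(m-1)$-cochains. A general position map is extended affinely to every simplex of $|S|$, and the extension is denoted by the same letter. Intersection numbers of surfaces: let $U\subset\mathbb{R}^a$, $V\subset\mathbb{R}^b$ be closures of their interiors, $a+b=M$, and $\varphi:U\to\mathbb{R}^M$, $\psi:V\to\mathbb{R}^M$ smooth parametrized surfaces. They intersect transversally at $p=\varphi(\alpha)=\psi(\beta)$, with $\alpha$ and $\beta$ interior points of $U$ and $V$, if the vectors $\partial_{u_1}\varphi|_\alpha,\dots,\partial_{u_a}\varphi|_\alpha,\partial_{v_1}\psi|_\beta,\dots,\partial_{v_b}\psi|_\beta$ span $\mathbb{R}^M$; the index of intersection there is the sign of the determinant of these vectors in this order. The surfaces are in general position if they intersect transversally only (in particular not at the boundary), and then their intersection number $\mathcal{I}(\varphi,\psi)$ is the sum of the indices over all intersections $p=\varphi(\alpha)=\psi(\beta)$. One also writes $\mathcal{I}(\varphi(U),\psi(V))$.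 Deformation cochain: let $f,g:\langle N\rangle\to\mathbb{R}^m$ be general position maps such that $\{f(i)\}\cup\{g(i)\}$ ($i\in\langle N\rangle$) is in general position, where $f(i)=g(j)$ is permitted only if $i=j$. The deformation map is $$h_{f,g}:|S|\times\mathbb{R}\to\mathbb{R}^m\times\mathbb{R},\qquad h_{f,g}(x,t)=(t f(x)+(1-t)g(x),\,t),$$ and the deformation cochain is $$\lambda_{f,g}(\tau_1\times\tau_2)=\mathcal{I}\big(h_{f,g}(|\tau_1|\times[0,1]),\,h_{f,g}(|\tau_2|\times[0,1])\big)$$ for $(m-1)$-cells $\tau_1\times\tau_2$ of $S^2_\Delta$. Here, for $\tau=\{s_0<\dots<s_d\}$, $|\tau|\times[0,1]$ carries the product orientation given by the parameters $(u_1,\dots,u_d,t)$ with $u_i\ge0$, $\sum u_i\le1$, where $u$ corresponds to the point $s_0+\sum_{i=1}^d u_i(s_i-s_0)$ of $|\tau|$. For $J=\{j_0<\dots<j_m\}\subset\langle N\rangle$: $\varepsilon_g(J)=\operatorname{sgn}\det\big(\binom{1}{g(j_0)},\dots,\binom{1}{g(j_m)}\big)$; $\ell_J^k=\#\big((J\setminus\{j_0\})\cap\{1,\dots,k\}\big)$; $\mathcal{P}_J=\{\tau_+\times\tau_-\in S^2_\Delta:\ \dim(\tau_+\times\tau_-)=m-1,\ \tau_+\cup\tau_-=J,\ j_0\in\tau_+\}$; and $\operatorname{sgn}(\tau_+,\tau_-)$ is the sign of the shuffle permutation that takes the sequence (elements of $\tau_+$ in increasing order, then elements of $\tau_-$ in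 increasing order) to the increasing order of $J$.
   Formalization: The deformation cochain is taken with the opposite sign (minus the intersection number), since the second and third bounds fail otherwise (m=N=1, f=(0,-1), g=(0,1)); it is assumed well defined, i.e. the surfaces meet only transversally, which general position of the points does not ensure. *)

theory Defs
  imports "HOL-Analysis.Analysis" "Jordan_Normal_Form.Determinant"
begin

text \<open>
  Points of \<open>\<real>\<^sup>n\<close> are elements of \<^term>\<open>topspace (Euclidean_space n)\<close>, i.e. functions
  \<^typ>\<open>nat \<Rightarrow> real\<close> that vanish at all indices \<open>\<ge> n\<close>; the coordinates are numbered from 0.
  The vertex set is \<open>{..N}\<close>, and a simplex is the set of its vertices.
\<close>

subsection \<open>General position\<close>

definition aff_independent :: "nat \<Rightarrow> 'i set \<Rightarrow> ('i \<Rightarrow> nat \<Rightarrow> real) \<Rightarrow> bool" where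
  "aff_independent m I x \<longleftrightarrow>
     (\<forall>c. (\<Sum>i\<in>I. c i) = 0 \<and> (\<forall>r<m. (\<Sum>i\<in>I. c i * x i r) = 0) \<longrightarrow> (\<forall>i\<in>I. c i = 0))"

definition general_position_map :: "nat \<Rightarrow> nat \<Rightarrow> (nat \<Rightarrow> nat \<Rightarrow> real) \<Rightarrow> bool" where
  "general_position_map m N f \<longleftrightarrow>
     f ` {..N} \<subseteq> topspace (Euclidean_space m) \<and>
     (\<forall>J. J \<subseteq> {..N} \<and> card J = m + 1 \<longrightarrow> aff_independent m J f)"

definition general_position_set :: "nat \<Rightarrow> (nat \<Rightarrow> real) set \<Rightarrow> bool" where
  "general_position_set m A \<longleftrightarrow>
     A \<subseteq> topspace (Euclidean_space m) \<and>
     (\<forall>B. B \<subseteq> A \<and> card B = m + 1 \<longrightarrow> aff_independent m B (\<lambda>p. p))"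

subsection \<open>The skeleton and its deleted product\<close>

definition skeleton :: "nat \<Rightarrow> nat \<Rightarrow> nat set set" where
  "skeleton m N = {\<sigma>. \<sigma> \<subseteq> {..N} \<and> \<sigma> \<noteq> {} \<and> card \<sigma> \<le> m + 1}"

definition simplex_dim :: "nat set \<Rightarrow> nat" where
  "simplex_dim \<sigma> = card \<sigma> - 1"

definition deleted_product :: "nat \<Rightarrow> nat \<Rightarrow> (nat set \<times> nat set) set" where
  "deleted_product m N =
     {(\<sigma>\<^sub>1, \<sigma>\<^sub>2). \<sigma>\<^sub>1 \<in> skeleton m N \<and> \<sigma>\<^sub>2 \<in> skeleton m N \<and> \<sigma>\<^sub>1 \<inter> \<sigma>\<^sub>2 = {}}"

text \<open>The \<open>(m - 1)\<close>-cells; there are none for \<open>m = 0\<close>.\<close>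

definition codim_cells :: "nat \<Rightarrow> nat \<Rightarrow> (nat set \<times> nat set) set" where
  "codim_cells m N =
     {(\<tau>\<^sub>1, \<tau>\<^sub>2) \<in> deleted_product m N. simplex_dim \<tau>\<^sub>1 + simplex_dim \<tau>\<^sub>2 + 1 = m}"

subsection \<open>Intersection numbers of parametrized surfaces\<close>

definition partial_deriv :: "((nat \<Rightarrow> real) \<Rightarrow> nat \<Rightarrow> real) \<Rightarrow> (nat \<Rightarrow> real) \<Rightarrow> nat \<Rightarrow> nat \<Rightarrow> real" where
  "partial_deriv \<phi> \<alpha> j r = deriv (\<lambda>s. \<phi> (\<alpha>(j := s)) r) (\<alpha> j)"

text \<open>
  The surfaces are \<open>\<phi> : U \<rightarrow> \<real>\<^sup>a\<^sup>+\<^sup>b\<close> with \<open>U \<subseteq> \<real>\<^sup>a\<close> and \<open>\<psi> : V \<rightarrow> \<real>\<^sup>a\<^sup>+\<^sup>b\<close> with \<open>V \<subseteq> \<real>\<^sup>b\<close>.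
  Here \<open>tangent a \<phi> \<psi> \<alpha> \<beta> j\<close> is the \<open>j\<close>-th of the \<open>a + b\<close> vectors
  \<open>\<partial>\<phi>/\<partial>u\<^sub>1, \<dots>, \<partial>\<phi>/\<partial>u\<^sub>a\<close> at \<open>\<alpha>\<close>, \<open>\<partial>\<psi>/\<partial>v\<^sub>1, \<dots>, \<partial>\<psi>/\<partial>v\<^sub>b\<close> at \<open>\<beta>\<close>.
\<close>

definition tangent ::
  "nat \<Rightarrow> ((nat \<Rightarrow> real) \<Rightarrow> nat \<Rightarrow> real) \<Rightarrow> ((nat \<Rightarrow> real) \<Rightarrow> nat \<Rightarrow> real) \<Rightarrow>
   (nat \<Rightarrow> real) \<Rightarrow> (nat \<Rightarrow> real) \<Rightarrow> nat \<Rightarrow> nat \<Rightarrow> real" where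
  "tangent a \<phi> \<psi> \<alpha> \<beta> j = (if j < a then partial_deriv \<phi> \<alpha> j else partial_deriv \<psi> \<beta> (j - a))"

definition intersections ::
  "(nat \<Rightarrow> real) set \<Rightarrow> ((nat \<Rightarrow> real) \<Rightarrow> nat \<Rightarrow> real) \<Rightarrow>
   (nat \<Rightarrow> real) set \<Rightarrow> ((nat \<Rightarrow> real) \<Rightarrow> nat \<Rightarrow> real) \<Rightarrow> ((nat \<Rightarrow> real) \<times> (nat \<Rightarrow> real)) set" where
  "intersections U \<phi> V \<psi> = {(\<alpha>, \<beta>). \<alpha> \<in> U \<and> \<beta> \<in> V \<and> \<phi> \<alpha> = \<psi> \<beta>}"

definition transversal_at ::
  "nat \<Rightarrow> (nat \<Rightarrow> real) set \<Rightarrow> ((nat \<Rightarrow> real) \<Rightarrow> nat \<Rightarrow> real) \<Rightarrow>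
   nat \<Rightarrow> (nat \<Rightarrow> real) set \<Rightarrow> ((nat \<Rightarrow> real) \<Rightarrow> nat \<Rightarrow> real) \<Rightarrow>
   (nat \<Rightarrow> real) \<Rightarrow> (nat \<Rightarrow> real) \<Rightarrow> bool" where
  "transversal_at a U \<phi> b V \<psi> \<alpha> \<beta> \<longleftrightarrow>
     \<alpha> \<in> Euclidean_space a interior_of U \<and> \<beta> \<in> Euclidean_space b interior_of V \<and>
     (\<forall>y. \<exists>c. \<forall>r<a + b. y r = (\<Sum>j<a + b. c j * tangent a \<phi> \<psi> \<alpha> \<beta> j r))"

definition surfaces_in_general_position ::
  "nat \<Rightarrow> (nat \<Rightarrow> real) set \<Rightarrow> ((nat \<Rightarrow> real) \<Rightarrow> nat \<Rightarrow> real) \<Rightarrow>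
   nat \<Rightarrow> (nat \<Rightarrow> real) set \<Rightarrow> ((nat \<Rightarrow> real) \<Rightarrow> nat \<Rightarrow> real) \<Rightarrow> bool" where
  "surfaces_in_general_position a U \<phi> b V \<psi> \<longleftrightarrow>
     (\<forall>(\<alpha>, \<beta>) \<in> intersections U \<phi> V \<psi>. transversal_at a U \<phi> b V \<psi> \<alpha> \<beta>)"

text \<open>The floors below only convert the real-valued \<^const>\<open>sgn\<close> to an integer.\<close>

definition intersection_index ::
  "nat \<Rightarrow> ((nat \<Rightarrow> real) \<Rightarrow> nat \<Rightarrow> real) \<Rightarrow> nat \<Rightarrow> ((nat \<Rightarrow> real) \<Rightarrow> nat \<Rightarrow> real) \<Rightarrow>
   (nat \<Rightarrow> real) \<Rightarrow> (nat \<Rightarrow> real) \<Rightarrow> int" where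
  "intersection_index a \<phi> b \<psi> \<alpha> \<beta> =
     \<lfloor>sgn (Determinant.det (Matrix.mat (a + b) (a + b) (\<lambda>(r, j). tangent a \<phi> \<psi> \<alpha> \<beta> j r)))\<rfloor>"

text \<open>Meaningful only for surfaces in general position.\<close>

definition intersection_number ::
  "nat \<Rightarrow> (nat \<Rightarrow> real) set \<Rightarrow> ((nat \<Rightarrow> real) \<Rightarrow> nat \<Rightarrow> real) \<Rightarrow>
   nat \<Rightarrow> (nat \<Rightarrow> real) set \<Rightarrow> ((nat \<Rightarrow> real) \<Rightarrow> nat \<Rightarrow> real) \<Rightarrow> int" where
  "intersection_number a U \<phi> b V \<psi> =
     (\<Sum>(\<alpha>, \<beta>) \<in> intersections U \<phi> V \<psi>. intersection_index a \<phi> b \<psi> \<alpha> \<beta>)"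

subsection \<open>The deformation cochain\<close>

text \<open>
  A point of \<open>|S|\<close> is given by its barycentric coordinates \<open>x : {..N} \<rightarrow> \<real>\<close>. The point \<open>(y, t)\<close> of
  \<open>\<real>\<^sup>m \<times> \<real>\<close> is the point of \<open>\<real>\<^sup>m\<^sup>+\<^sup>1\<close> with coordinates \<open>y\<^sub>0, \<dots>, y\<^sub>m\<^sub>-\<^sub>1, t\<close>.
\<close>

definition affine_extension :: "nat \<Rightarrow> (nat \<Rightarrow> nat \<Rightarrow> real) \<Rightarrow> (nat \<Rightarrow> real) \<Rightarrow> nat \<Rightarrow> real" where
  "affine_extension N f x r = (\<Sum>i\<le>N. x i * f i r)"

definition deformation_map ::
  "nat \<Rightarrow> nat \<Rightarrow> (nat \<Rightarrow> nat \<Rightarrow> real) \<Rightarrow> (nat \<Rightarrow> nat \<Rightarrow> real) \<Rightarrow> (nat \<Rightarrow> real) \<times> real \<Rightarrow> nat \<Rightarrow> real" where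
  "deformation_map m N f g = (\<lambda>(x, t) r.
     if r < m then t * affine_extension N f x r + (1 - t) * affine_extension N g x r
     else if r = m then t else 0)"

text \<open>
  For \<open>\<tau> = {s\<^sub>0 < \<dots> < s\<^sub>d}\<close>, the surface \<open>|\<tau>| \<times> [0, 1]\<close> is parametrized by
  \<open>w = (u\<^sub>1, \<dots>, u\<^sub>d, t)\<close>, that is \<open>u\<^sub>i = w (i - 1)\<close> and \<open>t = w d\<close>; \<open>simplex_point \<tau> w\<close> gives the
  barycentric coordinates of \<open>s\<^sub>0 + (\<Sum>i=1..d. u\<^sub>i (s\<^sub>i - s\<^sub>0))\<close>.
\<close>

definition simplex_point :: "nat set \<Rightarrow> (nat \<Rightarrow> real) \<Rightarrow> nat \<Rightarrow> real" where
  "simplex_point \<tau> w v =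
     (let s = sorted_list_of_set \<tau> in
      of_bool (v = s ! 0) +
      (\<Sum>i = 1..simplex_dim \<tau>. w (i - 1) * (of_bool (v = s ! i) - of_bool (v = s ! 0))))"

definition prism_domain :: "nat set \<Rightarrow> (nat \<Rightarrow> real) set" where
  "prism_domain \<tau> =
     {w \<in> topspace (Euclidean_space (simplex_dim \<tau> + 1)).
        (\<forall>i<simplex_dim \<tau>. 0 \<le> w i) \<and> (\<Sum>i<simplex_dim \<tau>. w i) \<le> 1 \<and>
        w (simplex_dim \<tau>) \<in> {0..1}}"

definition prism_surface ::
  "nat \<Rightarrow> nat \<Rightarrow> (nat \<Rightarrow> nat \<Rightarrow> real) \<Rightarrow> (nat \<Rightarrow> nat \<Rightarrow> real) \<Rightarrow> nat set \<Rightarrow>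
   (nat \<Rightarrow> real) \<Rightarrow> nat \<Rightarrow> real" where
  "prism_surface m N f g \<tau> w = deformation_map m N f g (simplex_point \<tau> w, w (simplex_dim \<tau>))"

text \<open>
  The deformation cochain is defined only if, for every \<open>(m - 1)\<close>-cell, the two surfaces
  are in general position. This does not follow from affine independence of the points \<open>f i\<close> and
  \<open>g i\<close>: for \<open>m = 2\<close> it fails as soon as \<open>f 1 - f 2\<close> is a negative multiple of \<open>g 1 - g 2\<close>.
\<close>

definition deformation_cochain_defined ::
  "nat \<Rightarrow> nat \<Rightarrow> (nat \<Rightarrow> nat \<Rightarrow> real) \<Rightarrow> (nat \<Rightarrow> nat \<Rightarrow> real) \<Rightarrow> bool" where
  "deformation_cochain_defined m N f g \<longleftrightarrow>
     (\<forall>(\<tau>\<^sub>1, \<tau>\<^sub>2) \<in> codim_cells m N.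
        surfaces_in_general_position
          (simplex_dim \<tau>\<^sub>1 + 1) (prism_domain \<tau>\<^sub>1) (prism_surface m N f g \<tau>\<^sub>1)
          (simplex_dim \<tau>\<^sub>2 + 1) (prism_domain \<tau>\<^sub>2) (prism_surface m N f g \<tau>\<^sub>2))"

text \<open>
  The minus sign is the choice of orientation of the target \<open>\<real>\<^sup>m \<times> \<real>\<close>: intersections there are
  counted with respect to the orientation opposite to that of the basis \<open>e\<^sub>0, \<dots>, e\<^sub>m\<^sub>-\<^sub>1, \<partial>/\<partial>t\<close>.
  It is essential. With \<open>m = N = 1\<close>, \<open>g = (0, 1)\<close>, \<open>f = (0, -1)\<close> the two curves are \<open>(0, t)\<close>
  and \<open>(1 - 2t, t)\<close>, with tangent vectors \<open>(0, 1)\<close>, \<open>(-2, 1)\<close> of determinant 2, so the basis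
  orientation would give the cell \<open>{0} \<times> {1}\<close> the value \<open>+1\<close>, while \<open>\<epsilon>\<^sub>g = 1\<close>. In every dimension,
  the basis orientation makes the first sign change of the orientation of \<open>t f(J) + (1 - t) g(J)\<close>,
  going from \<open>g\<close> to \<open>f\<close>, contribute \<open>+1\<close> to
  \<open>\<epsilon>\<^sub>g(J) \<Sum> sgn(\<tau>\<^sub>+, \<tau>\<^sub>-) \<lambda>(\<tau>\<^sub>+ \<times> \<tau>\<^sub>-)\<close>; the bounds of interest need it to contribute \<open>-1\<close>.
\<close>

definition deformation_cochain ::
  "nat \<Rightarrow> nat \<Rightarrow> (nat \<Rightarrow> nat \<Rightarrow> real) \<Rightarrow> (nat \<Rightarrow> nat \<Rightarrow> real) \<Rightarrow> nat set \<times> nat set \<Rightarrow> int" where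
  "deformation_cochain m N f g = (\<lambda>(\<tau>\<^sub>1, \<tau>\<^sub>2).
     - intersection_number
         (simplex_dim \<tau>\<^sub>1 + 1) (prism_domain \<tau>\<^sub>1) (prism_surface m N f g \<tau>\<^sub>1)
         (simplex_dim \<tau>\<^sub>2 + 1) (prism_domain \<tau>\<^sub>2) (prism_surface m N f g \<tau>\<^sub>2))"

subsection \<open>Combinatorial data of a vertex set \<open>J\<close>\<close>

definition simplex_orientation :: "nat \<Rightarrow> (nat \<Rightarrow> nat \<Rightarrow> real) \<Rightarrow> nat set \<Rightarrow> int" where
  "simplex_orientation m g J =
     \<lfloor>sgn (Determinant.det (Matrix.mat (m + 1) (m + 1)
        (\<lambda>(r, j). if r = 0 then 1 else g (sorted_list_of_set J ! j) (r - 1))))\<rfloor>"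

definition fixed_count :: "nat \<Rightarrow> nat set \<Rightarrow> nat" where
  "fixed_count k J = card ((J - {Min J}) \<inter> {1..k})"

definition partition_cells :: "nat \<Rightarrow> nat \<Rightarrow> nat set \<Rightarrow> (nat set \<times> nat set) set" where
  "partition_cells m N J =
     {(\<tau>\<^sub>p, \<tau>\<^sub>m) \<in> codim_cells m N. \<tau>\<^sub>p \<union> \<tau>\<^sub>m = J \<and> Min J \<in> \<tau>\<^sub>p}"

text \<open>
  Positions in the sequence (\<open>\<tau>\<^sub>p\<close> increasing, then \<open>\<tau>\<^sub>m\<close> increasing) are mapped to positions in the
  increasing order of \<open>\<tau>\<^sub>p \<union> \<tau>\<^sub>m\<close>.
\<close>

definition shuffle_perm :: "nat set \<Rightarrow> nat set \<Rightarrow> nat \<Rightarrow> nat" where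
  "shuffle_perm \<tau>\<^sub>p \<tau>\<^sub>m i =
     (let s = sorted_list_of_set \<tau>\<^sub>p @ sorted_list_of_set \<tau>\<^sub>m
      in if i < length s then card {j \<in> \<tau>\<^sub>p \<union> \<tau>\<^sub>m. j < s ! i} else i)"

definition shuffle_sign :: "nat set \<times> nat set \<Rightarrow> int" where
  "shuffle_sign = (\<lambda>(\<tau>\<^sub>p, \<tau>\<^sub>m). sign (shuffle_perm \<tau>\<^sub>p \<tau>\<^sub>m))"

end

theory Submission
  imports Defs
begin

text \<open>
  Let \<open>D t\<close> be the determinant of the points \<open>t f(j) + (1 - t) g(j)\<close>, \<open>j \<in> J\<close>, with a row of ones
  added. It is a polynomial in \<open>t\<close> of degree at most \<open>m - \<ell>\<close>. A root in \<open>(0, 1)\<close> is a time at which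
  these points are affinely dependent, and the signs of the coefficients of a dependency split \<open>J\<close>
  into a cell of \<open>P\<^sub>J\<close> whose prisms intersect at that time. Transversality forbids vanishing
  coefficients, hence the dependency is unique up to scaling, and the roots of \<open>D\<close> in \<open>(0, 1)\<close>
  correspond bijectively to the intersections counted by \<open>\<lambda>\<close> on all cells of \<open>P\<^sub>J\<close>. They are simple,
  and an intersection contributes the sign of \<open>D'\<close> to \<open>sgn(\<tau>\<^sub>+, \<tau>\<^sub>-) \<lambda>(\<tau>\<^sub>+ \<times> \<tau>\<^sub>-)\<close>. These signs alternate
  and begin with \<open>- \<epsilon>\<^sub>g(J)\<close>, which yields all three bounds.
\<close>

subsection \<open>Determinants\<close>

text \<open>The index of an intersection and the derivative of \<open>D\<close> come from different
  matrices. The tangent matrix has a row of time components that is one in exactly two columns and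
  zero elsewhere; a change of basis gives the row of ones in \<open>D\<close> the same shape.
  Subtracting one of the two columns from the other and expanding along the row leaves the same m by
  m determinant in both cases, up to a known sign. In \<open>D\<close> the difference column is
  divisible by the distance to the crossing time, so the derivative is read off from a linear factor
  times a continuous function. A dependency fixes its cell only up to exchanging the two simplices;
  the condition that \<open>Min J\<close> lie in the first one removes this ambiguity. Affine
  independence of g(J) and f(J) makes \<open>D\<close> nonzero at 0 and 1. The signs of the
  derivative over the roots therefore add up to half of \<open>sgn (D 1) - sgn (D 0)\<close>, which
  is 0 or -1 after multiplication by the orientation of g(J). So the roots whose sign is opposite to
  that orientation equal the others in number or exceed them by one: hence a ceiling in the lower
  bound and a floor in the upper one.\<close>

definition matdet :: "nat \<Rightarrow> (nat \<Rightarrow> nat \<Rightarrow> real) \<Rightarrow> real" where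
  "matdet n a = Determinant.det (Matrix.mat n n (\<lambda>(i, j). a i j))"

lemma matdet_cong:
  "(\<And>i j. i < n \<Longrightarrow> j < n \<Longrightarrow> a i j = b i j) \<Longrightarrow> matdet n a = matdet n b"
  unfolding matdet_def by (rule arg_cong[of _ _ Determinant.det]) (auto intro!: eq_matI)

lemma matdet_mult:
  "matdet n (\<lambda>i j. \<Sum>k<n. a i k * b k j) = matdet n a * matdet n b"
proof -
  have "matdet n a * matdet n b =
      Determinant.det (Matrix.mat n n (\<lambda>(i, j). a i j) * Matrix.mat n n (\<lambda>(i, j). b i j))"
    unfolding matdet_def by (rule det_mult[symmetric]) auto
  also have "Matrix.mat n n (\<lambda>(i, j). a i j) * Matrix.mat n n (\<lambda>(i, j). b i j) =
      Matrix.mat n n (\<lambda>(i, j). \<Sum>k<n. a i k * b k j)"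
    by (auto intro!: eq_matI sum.cong simp: scalar_prod_def atLeast0LessThan)
  finally show ?thesis by (simp add: matdet_def)
qed

lemma matdet_upper_triangular:
  assumes "\<And>i j. j < i \<Longrightarrow> i < n \<Longrightarrow> a i j = 0"
  shows "matdet n a = (\<Prod>i<n. a i i)"
proof -
  have "matdet n a = prod_list (diag_mat (Matrix.mat n n (\<lambda>(i, j). a i j)))"
    unfolding matdet_def
    by (rule det_upper_triangular[where n = n]) (auto simp: assms)
  also have "\<dots> = (\<Prod>i<n. a i i)"
    by (simp add: diag_mat_def prod.distinct_set_conv_list[symmetric] atLeast0LessThan)
  finally show ?thesis .
qed

lemma matdet_row_Laplace:
  assumes "r \<le> n"
  shows "matdet (Suc n) a =
    (\<Sum>j\<le>n. a r j * ((-1) ^ (r + j) *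
       matdet n (\<lambda>i k. a (insert_index r i) (insert_index j k))))"
proof -
  let ?A = "Matrix.mat (Suc n) (Suc n) (\<lambda>(i, j). a i j)"
  have "matdet (Suc n) a = (\<Sum>j<Suc n. ?A $$ (r, j) * cofactor ?A r j)"
    unfolding matdet_def by (rule laplace_expansion_row) (use assms in auto)
  also have "\<dots> = (\<Sum>j\<le>n. a r j * ((-1) ^ (r + j) *
       matdet n (\<lambda>i k. a (insert_index r i) (insert_index j k))))"
  proof (unfold lessThan_Suc_atMost, intro sum.cong refl)
    fix j assume j: "j \<in> {..n}"
    have "mat_delete ?A r j =
      Matrix.mat n n (\<lambda>(i, k). a (insert_index r i) (insert_index j k))"
      using j assms by (intro eq_matI) (auto simp: mat_delete_def insert_index_def)
    then show "?A $$ (r, j) * cofactor ?A r j = a r j * ((-1) ^ (r + j) *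
       matdet n (\<lambda>i k. a (insert_index r i) (insert_index j k)))"
      using j assms by (simp add: cofactor_def matdet_def)
  qed
  finally show ?thesis .
qed

lemma matdet_unit_row:
  assumes "r \<le> n" "p \<le> n" "\<And>j. j \<le> n \<Longrightarrow> a r j = (if j = p then 1 else 0)"
  shows "matdet (Suc n) a =
    (-1) ^ (r + p) * matdet n (\<lambda>i k. a (insert_index r i) (insert_index p k))"
proof -
  have "matdet (Suc n) a = (\<Sum>j\<le>n. if j = p then
     (-1) ^ (r + p) * matdet n (\<lambda>i k. a (insert_index r i) (insert_index p k)) else 0)"
    unfolding matdet_row_Laplace[OF assms(1)] by (intro sum.cong refl) (auto simp: assms)
  then show ?thesis using assms by simp
qed

text \<open>Subtracting column \<open>p\<close> from column \<open>n\<close> turns row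
  \<open>r\<close> into a unit row. The expansion then deletes column \<open>p\<close>, which leaves
  the difference as the last column. This serves both the row of ones and the time row of the
  tangent matrix.\<close>

lemma matdet_two_unit_row:
  assumes "r \<le> n" "p < n" "\<And>j. j \<le> n \<Longrightarrow> a r j = (if j = p \<or> j = n then 1 else 0)"
  shows "matdet (Suc n) a = (-1) ^ (r + p) *
    matdet n (\<lambda>i k. if Suc k = n then a (insert_index r i) n - a (insert_index r i) p
                    else a (insert_index r i) (insert_index p k))"
proof -
  define u :: "nat \<Rightarrow> nat \<Rightarrow> real" where
    "u k j = (if k = j then 1 else if k = p \<and> j = n then -1 else 0)" for k j
  let ?b = "\<lambda>i j. if j = n then a i n - a i p else a i j"
  have u: "matdet (Suc n) u = 1"
    by (subst matdet_upper_triangular) (use assms(2) in \<open>auto simp: u_def\<close>)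
  have "matdet (Suc n) a = matdet (Suc n) (\<lambda>i j. \<Sum>k<Suc n. a i k * u k j)"
    by (simp only: matdet_mult u)
  also have "\<dots> = matdet (Suc n) ?b"
  proof (rule matdet_cong)
    fix i j assume "j < Suc n"
    show "(\<Sum>k<Suc n. a i k * u k j) = ?b i j"
    proof (cases "j = n")
      case True
      have "(\<Sum>k<Suc n. a i k * u k j) =
        (\<Sum>k<Suc n. (if k = n then a i k else 0) - (if k = p then a i k else 0))"
        using True assms(2) by (intro sum.cong) (auto simp: u_def)
      then show ?thesis using True assms(2) by (simp add: sum_subtractf)
    next
      case False
      have "(\<Sum>k<Suc n. a i k * u k j) = (\<Sum>k<Suc n. if k = j then a i k else 0)"
        using False by (intro sum.cong) (auto simp: u_def)
      then show ?thesis using False \<open>j < Suc n\<close> by simp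
    qed
  qed
  also have "\<dots> = (-1) ^ (r + p) *
      matdet n (\<lambda>i k. ?b (insert_index r i) (insert_index p k))"
    by (rule matdet_unit_row) (use assms in auto)
  also have "matdet n (\<lambda>i k. ?b (insert_index r i) (insert_index p k)) =
    matdet n (\<lambda>i k. if Suc k = n then a (insert_index r i) n - a (insert_index r i) p
                    else a (insert_index r i) (insert_index p k))"
    using assms(2) by (intro matdet_cong) (auto simp: insert_index_def)
  finally show ?thesis .
qed

text \<open>Serves to extract the factor \<open>z - t\<close> from the column joining the two points
  that meet at time \<open>t\<close>.\<close>

lemma matdet_scale_last:
  "matdet (Suc n) (\<lambda>i j. if j = n then s * a i j else a i j) = s * matdet (Suc n) a"
proof -
  let ?d = "\<lambda>k j. if k = j then if j = n then s else 1 else 0"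
  have "matdet (Suc n) (\<lambda>i j. if j = n then s * a i j else a i j) =
      matdet (Suc n) (\<lambda>i j. \<Sum>k<Suc n. a i k * ?d k j)"
  proof (rule matdet_cong)
    fix i j assume "j < Suc n"
    have "(\<Sum>k<Suc n. a i k * ?d k j) =
        (\<Sum>k<Suc n. if k = j then a i k * (if j = n then s else 1) else 0)"
      by (intro sum.cong) auto
    then show "(if j = n then s * a i j else a i j) = (\<Sum>k<Suc n. a i k * ?d k j)"
      using \<open>j < Suc n\<close> by simp
  qed
  also have "\<dots> = matdet (Suc n) a * (\<Prod>j<Suc n. ?d j j)"
    unfolding matdet_mult by (subst (2) matdet_upper_triangular) auto
  also have "(\<Prod>j<Suc n. ?d j j) = s" by simp
  finally show ?thesis by simp
qed

lemma matdet_transpose: "matdet n (\<lambda>i j. a j i) = matdet n a"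
proof -
  have "Matrix.mat n n (\<lambda>(i, j). a j i) = transpose_mat (Matrix.mat n n (\<lambda>(i, j). a i j))"
    by (auto intro!: eq_matI)
  then show ?thesis unfolding matdet_def by (simp add: det_transpose[where n = n])
qed

text \<open>Source of the shuffle sign: the columns pass from the increasing order of
  \<open>J\<close> to the order that lists one simplex after the other.\<close>

lemma matdet_permute_columns:
  assumes "\<pi> permutes {..<n}"
  shows "matdet n (\<lambda>i j. a i (\<pi> j)) = of_int (sign \<pi>) * matdet n a"
proof -
  let ?T = "Matrix.mat n n (\<lambda>(i, j). a j i)"
  have \<pi>: "\<pi> permutes {0..<n}" using assms by (simp add: atLeast0LessThan)
  have lt: "\<pi> i < n" if "i < n" for i
    using assms that by (metis lessThan_iff permutes_in_image)
  have "matdet n (\<lambda>i j. a i (\<pi> j)) = matdet n (\<lambda>i j. a j (\<pi> i))"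
    by (rule matdet_transpose[symmetric])
  also have "\<dots> = Determinant.det (Matrix.mat n n (\<lambda>(i, j). ?T $$ (\<pi> i, j)))"
    unfolding matdet_def by (rule arg_cong[of _ _ Determinant.det]) (auto intro!: eq_matI simp: lt)
  also have "\<dots> = of_int (sign \<pi>) * Determinant.det ?T"
    by (rule det_permute_rows) (auto simp: \<pi>)
  also have "Determinant.det ?T = matdet n (\<lambda>i j. a j i)" by (simp add: matdet_def)
  also have "\<dots> = matdet n a" by (rule matdet_transpose)
  finally show ?thesis .
qed

text \<open>For the change of basis that acts on two disjoint simplices separately.\<close>

lemma matdet_block_diagonal:
  "matdet (p + q) (\<lambda>i j. if i < p \<and> j < p then a i j
      else if p \<le> i \<and> p \<le> j then b (i - p) (j - p) else 0) = matdet p a * matdet q b"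
proof -
  let ?A = "Matrix.mat p p (\<lambda>(i, j). a i j)" and ?B = "Matrix.mat q q (\<lambda>(i, j). b i j)"
  have "Matrix.mat (p + q) (p + q) (\<lambda>(i, j). if i < p \<and> j < p then a i j
      else if p \<le> i \<and> p \<le> j then b (i - p) (j - p) else 0) =
      four_block_mat ?A (0\<^sub>m p q) (0\<^sub>m q p) ?B"
    by (rule eq_matI) auto
  then show ?thesis unfolding matdet_def
    using det_four_block_mat_upper_right_zero[of ?A p "0\<^sub>m p q" q "0\<^sub>m q p" ?B] by simp
qed

text \<open>
  The columns are \<open>e\<^sub>1 - e\<^sub>0, \<dots>, e\<^sub>p - e\<^sub>0\<close> and \<open>x\<close>; adding all rows to row 0 makes that row
  \<open>(0, \<dots>, 0, \<Sum>x)\<close>.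
\<close>
lemma matdet_edge_basis:
  assumes "(\<Sum>k\<le>p. x k) = 1"
  shows "matdet (Suc p) (\<lambda>k j. if j < p then of_bool (k = Suc j) - of_bool (k = 0) else x k) =
    (-1) ^ p"
proof -
  let ?Q = "\<lambda>k j. if j < p then of_bool (k = Suc j) - of_bool (k = 0) else x k"
  let ?L = "\<lambda>i k::nat. if i = 0 \<or> i = k then 1 else 0 :: real"
  let ?R = "\<lambda>i j. if i = 0 then if j = p then 1 else 0 else ?Q i j"
  have L: "matdet (Suc p) ?L = 1"
    by (subst matdet_upper_triangular) auto
  have "matdet (Suc p) ?Q = matdet (Suc p) (\<lambda>i j. \<Sum>k<Suc p. ?L i k * ?Q k j)"
    by (simp only: matdet_mult L mult_1)
  also have "\<dots> = matdet (Suc p) ?R"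
  proof (rule matdet_cong)
    fix i j assume ij: "i < Suc p" "j < Suc p"
    show "(\<Sum>k<Suc p. ?L i k * ?Q k j) = ?R i j"
    proof (cases "i = 0")
      case True
      show ?thesis
      proof (cases "j = p")
        case True
        then show ?thesis using \<open>i = 0\<close> assms by (simp add: lessThan_Suc_atMost del: sum.lessThan_Suc)
      next
        case False
        have "(\<Sum>k<Suc p. ?L i k * ?Q k j) =
            (\<Sum>k<Suc p. (if k = Suc j then 1 else 0) - (if k = 0 then 1 else 0 :: real))"
          using False ij True by (intro sum.cong) auto
        also have "\<dots> = 0" using False ij by (simp add: sum_subtractf del: sum.lessThan_Suc)
        finally show ?thesis using False True by simp
      qed
    next
      case False
      have "(\<Sum>k<Suc p. ?L i k * ?Q k j) = (\<Sum>k<Suc p. if k = i then ?Q k j else 0)"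
        using False by (intro sum.cong) auto
      then show ?thesis using False ij by simp
    qed
  qed
  \<comment> \<open>Row 0 is now the unit row at \<open>p\<close>. Without it and column
    \<open>p\<close> the identity remains, since edge \<open>j\<close> has its entry 1 in row
    \<open>j + 1\<close>.\<close>
  also have "\<dots> = (-1) ^ (0 + p) * matdet p (\<lambda>i k. ?R (insert_index 0 i) (insert_index p k))"
    by (rule matdet_unit_row) auto
  also have "matdet p (\<lambda>i k. ?R (insert_index 0 i) (insert_index p k)) =
      matdet p (\<lambda>i k. if i = k then 1 else 0)"
    by (rule matdet_cong) (auto simp: insert_index_def)
  also have "\<dots> = 1" by (subst matdet_upper_triangular) auto
  finally show ?thesis by simp
qed

text \<open>Continuity of the factor beside \<open>z - t\<close> is what Caratheodory's criterion
  asks for when \<open>deformed_det\<close> is differentiated at a root.\<close>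

lemma isCont_matdet:
  assumes "\<And>i j. i < n \<Longrightarrow> j < n \<Longrightarrow> isCont (\<lambda>t. a t i j) t"
  shows "isCont (\<lambda>t. matdet n (a t)) t"
proof -
  have lt: "\<pi> i < n" if "\<pi> permutes {0..<n}" "i < n" for \<pi> i
    using that by (metis atLeastLessThan_iff le0 permutes_in_image)
  have "matdet n (a s) = (\<Sum>\<pi> | \<pi> permutes {0..<n}. signof \<pi> * (\<Prod>i = 0..<n. a s i (\<pi> i)))" for s
    unfolding matdet_def by (subst det_def') (auto intro!: sum.cong prod.cong simp: lt)
  moreover have "isCont (\<lambda>s. \<Sum>\<pi> | \<pi> permutes {0..<n}. signof \<pi> * (\<Prod>i = 0..<n. a s i (\<pi> i))) t"
    by (intro continuous_sum continuous_mult continuous_const continuous_prod assms) (auto simp: lt)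
  ultimately show ?thesis by simp
qed

text \<open>In the Leibniz formula every permutation meets each column once, and a column in
  \<open>Z\<close> contributes a constant; so each product has degree at most the number of columns
  outside \<open>Z\<close>.\<close>

lemma matdet_affine_columns_poly:
  assumes "\<And>i j. i < n \<Longrightarrow> j < n \<Longrightarrow> j \<in> Z \<Longrightarrow> v i j = 0"
  shows "\<exists>p. (\<forall>t. poly p t = matdet n (\<lambda>i j. u i j + t * v i j)) \<and> degree p \<le> card ({..<n} - Z)"
proof -
  define P where "P = (\<Sum>\<pi> | \<pi> permutes {0..<n}.
      signof \<pi> * (\<Prod>i = 0..<n. [:u i (\<pi> i), v i (\<pi> i):]))"
  have lt: "\<pi> i < n" if "\<pi> permutes {0..<n}" "i < n" for \<pi> i
    using that by (metis atLeastLessThan_iff le0 permutes_in_image)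
  have "poly P t = matdet n (\<lambda>i j. u i j + t * v i j)" for t
    unfolding matdet_def P_def
    by (subst det_def') (auto intro!: sum.cong prod.cong simp: lt poly_sum poly_prod sign_def)
  moreover have "degree P \<le> card ({..<n} - Z)"
    unfolding P_def
  proof (rule degree_sum_le)
    show "finite {\<pi>. \<pi> permutes {0..<n}}" by (simp add: finite_permutations)
    fix \<pi> assume "\<pi> \<in> {\<pi>. \<pi> permutes {0..<n}}"
    then have \<pi>: "\<pi> permutes {0..<n}" by simp
    have "degree (signof \<pi> * (\<Prod>i = 0..<n. [:u i (\<pi> i), v i (\<pi> i):])) =
        degree (\<Prod>i = 0..<n. [:u i (\<pi> i), v i (\<pi> i):])"
      by (auto simp: sign_def)
    also have "\<dots> \<le> (\<Sum>i = 0..<n. degree [:u i (\<pi> i), v i (\<pi> i):])"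
      using degree_prod_sum_le[of "{0..<n}" "\<lambda>i. [:u i (\<pi> i), v i (\<pi> i):]"] by (simp add: o_def)
    also have "\<dots> \<le> (\<Sum>i = 0..<n. of_bool (\<pi> i \<notin> Z))"
      by (intro sum_mono) (auto simp: assms lt[OF \<pi>])
    also have "\<dots> = (\<Sum>i = 0..<n. of_bool (i \<notin> Z))"
      using sum.permute[OF \<pi>, of "\<lambda>i. of_bool (i \<notin> Z) :: nat"] by (simp add: o_def)
    also have "\<dots> = card ({..<n} - Z)"
      by (simp add: of_bool_def sum.If_cases atLeast0LessThan Diff_eq Compl_eq)
    finally show "degree (signof \<pi> * (\<Prod>i = 0..<n. [:u i (\<pi> i), v i (\<pi> i):])) \<le> card ({..<n} - Z)" .
  qed
  ultimately show ?thesis by blast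
qed

subsection \<open>Simple roots\<close>

text \<open>Successive roots have derivatives of alternating signs.\<close>
lemma sum_sgn_deriv_roots:
  fixes f f' :: "real \<Rightarrow> real"
  assumes "a < b" "f a \<noteq> 0" "f b \<noteq> 0"
    and "finite {x \<in> {a<..<b}. f x = 0}"
    and deriv: "\<And>x. (f has_real_derivative f' x) (at x)"
    and simple: "\<And>x. x \<in> {a<..<b} \<Longrightarrow> f x = 0 \<Longrightarrow> f' x \<noteq> 0"
  shows "2 * (\<Sum>x | x \<in> {a<..<b} \<and> f x = 0. sgn (f' x)) = sgn (f b) - sgn (f a)"
  using assms(1-4) simple
proof (induction "card {x \<in> {a<..<b}. f x = 0}" arbitrary: b rule: less_induct)
  \<comment> \<open>The largest root \<open>r\<close> is split off, and \<open>b\<close> is replaced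
    by a point \<open>c\<close> between \<open>r\<close> and all other roots.\<close>
  case less
  have cont: "continuous_on A f" for A
    using deriv by (meson DERIV_isCont continuous_at_imp_continuous_on)
  \<comment> \<open>Without a root in between, the intermediate value theorem forbids a change of
    sign.\<close>
  have const: "sgn (f x) = sgn (f y)" if "x \<le> y" "\<And>z. z \<in> {x..y} \<Longrightarrow> f z \<noteq> 0" for x y
  proof (rule ccontr)
    assume "sgn (f x) \<noteq> sgn (f y)"
    moreover have "f x \<noteq> 0" "f y \<noteq> 0" using that by auto
    ultimately have "(f x < 0 \<and> 0 < f y) \<or> (f y < 0 \<and> 0 < f x)"
      by (auto simp: sgn_if split: if_splits)
    then have "\<exists>z. x \<le> z \<and> z \<le> y \<and> f z = 0"
      using IVT'[of f x 0 y] IVT2'[of f y 0 x] that(1) cont by force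
    then show False using that(2) by auto
  qed
  let ?R = "\<lambda>b. {x \<in> {a<..<b}. f x = 0}"
  show ?case
  proof (cases "?R b = {}")
    case True
    have "sgn (f a) = sgn (f b)"
    proof (rule const)
      fix z assume "z \<in> {a..b}"
      then show "f z \<noteq> 0" using True less.prems by (cases "z = a \<or> z = b") force+
    qed (use less.prems in auto)
    then show ?thesis unfolding True by simp
  next
    case False
    define r where "r = Max (?R b)"
    have rR: "r \<in> ?R b" unfolding r_def using False less.prems(4) by (intro Max_in) auto
    have rmax: "x \<le> r" if "x \<in> ?R b" for x
      unfolding r_def using that less.prems(4) by (intro Max_ge) auto
    have f'r: "f' r \<noteq> 0" using less.prems(5) rR by auto
    have fr: "f r = 0" using rR by simp
    have "\<exists>d>0. \<forall>h>0. h < d \<longrightarrow> sgn (f (r + h)) = sgn (f' r) \<and> sgn (f (r - h)) = - sgn (f' r)"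
    proof (cases "f' r > 0")
      case True
      obtain d1 where d1: "d1 > 0" "\<And>h. h > 0 \<Longrightarrow> h < d1 \<Longrightarrow> f r < f (r + h)"
        using DERIV_pos_inc_right[OF deriv True] by blast
      obtain d2 where d2: "d2 > 0" "\<And>h. h > 0 \<Longrightarrow> h < d2 \<Longrightarrow> f (r - h) < f r"
        using DERIV_pos_inc_left[OF deriv True] by blast
      show ?thesis
      proof (intro exI[of _ "min d1 d2"] conjI allI impI)
        fix h assume "h > 0" "h < min d1 d2"
        with d1(2)[of h] d2(2)[of h] fr True
        show "sgn (f (r + h)) = sgn (f' r)" "sgn (f (r - h)) = - sgn (f' r)" by auto
      qed (use d1(1) d2(1) in auto)
    next
      case False
      with f'r have neg: "f' r < 0" by simp
      obtain d1 where d1: "d1 > 0" "\<And>h. h > 0 \<Longrightarrow> h < d1 \<Longrightarrow> f (r + h) < f r"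
        using DERIV_neg_dec_right[OF deriv neg] by blast
      obtain d2 where d2: "d2 > 0" "\<And>h. h > 0 \<Longrightarrow> h < d2 \<Longrightarrow> f r < f (r - h)"
        using DERIV_neg_dec_left[OF deriv neg] by blast
      show ?thesis
      proof (intro exI[of _ "min d1 d2"] conjI allI impI)
        fix h assume "h > 0" "h < min d1 d2"
        with d1(2)[of h] d2(2)[of h] fr neg
        show "sgn (f (r + h)) = sgn (f' r)" "sgn (f (r - h)) = - sgn (f' r)" by auto
      qed (use d1(1) d2(1) in auto)
    qed
    then obtain d where d: "d > 0"
      "\<And>h. h > 0 \<Longrightarrow> h < d \<Longrightarrow> sgn (f (r + h)) = sgn (f' r) \<and> sgn (f (r - h)) = - sgn (f' r)"
      by blast
    have "\<exists>c. a < c \<and> c < r \<and> (\<forall>x\<in>?R b - {r}. x < c)"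
    proof -
      let ?X = "insert a (?R b - {r})"
      have fin: "finite ?X" using less.prems(4) by simp
      have "Max ?X \<in> ?X" by (rule Max_in) (use fin in auto)
      then have "Max ?X < r" using rmax rR by force
      then obtain c where c: "Max ?X < c" "c < r" using dense by blast
      have "x < c" if "x \<in> ?X" for x using Max_ge[OF fin that] c(1) by linarith
      then show ?thesis using c by auto
    qed
    then obtain c0 where c0: "a < c0" "c0 < r" "\<And>x. x \<in> ?R b - {r} \<Longrightarrow> x < c0" by blast
    \<comment> \<open>Halving the minimum makes all bounds strict: \<open>r - h\<close> stays to the
      right of \<open>c0\<close>, \<open>r + h\<close> to the left of \<open>b\<close>, and both lie
      where the sign of \<open>f\<close> is known from \<open>f' r\<close>.\<close>
    define h where "h = Min {d, r - c0, b - r} / 2"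
    have h: "h > 0" "h < d" "h < r - c0" "h < b - r"
      using d(1) c0 rR unfolding h_def by (auto simp: min_def)
    define c where "c = r - h"
    have c: "a < c" "c < r" "\<And>x. x \<in> ?R b - {r} \<Longrightarrow> x < c"
      using c0 h unfolding c_def by (auto, fastforce)
    have sc: "sgn (f c) = - sgn (f' r)" using d(2)[of h] h unfolding c_def by auto
    have "sgn (f (r + h)) = sgn (f b)"
    proof (rule const)
      fix z assume "z \<in> {r + h..b}"
      then show "f z \<noteq> 0" using rmax[of z] h less.prems rR by (cases "z = b") force+
    qed (use h in auto)
    then have sb: "sgn (f b) = sgn (f' r)" using d(2)[of h] h by auto
    have Rc: "?R b = insert r (?R c)" using c rR by force
    have rn: "r \<notin> ?R c" using c by auto
    have fc: "f c \<noteq> 0" using sc f'r by (auto simp: sgn_if split: if_splits)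
    have fin: "finite (?R c)" using less.prems(4) Rc by simp
    have "card (?R c) < card (?R b)" using Rc rn fin by simp
    then have "2 * (\<Sum>x | x \<in> {a<..<c} \<and> f x = 0. sgn (f' x)) = sgn (f c) - sgn (f a)"
    proof (rule less.hyps)
      fix x assume "x \<in> {a<..<c}" "f x = 0"
      then show "f' x \<noteq> 0" using less.prems(5)[of x] c rR by auto
    qed (fact c(1) less.prems(2) fc fin)+
    moreover have "(\<Sum>x\<in>?R b. sgn (f' x)) = sgn (f' r) + (\<Sum>x\<in>?R c. sgn (f' x))"
      unfolding Rc using rn fin by (rule sum.insert[rotated])
    \<comment> \<open>The signs at \<open>c\<close> and \<open>b\<close> are
      \<open>- sgn (f' r)\<close> and \<open>sgn (f' r)\<close>, so passing \<open>r\<close> adds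
      \<open>2 * sgn (f' r)\<close> to both sides.\<close>
    ultimately show ?thesis using sc sb by linarith
  qed
qed

subsection \<open>Prism surfaces\<close>

lemma length_sorted_simplex:
  "finite \<tau> \<Longrightarrow> \<tau> \<noteq> {} \<Longrightarrow> length (sorted_list_of_set \<tau>) = Suc (simplex_dim \<tau>)"
  by (simp add: simplex_dim_def card_gt_0_iff)

lemma sum_sorted_simplex:
  assumes "finite \<tau>" "\<tau> \<noteq> {}"
  shows "(\<Sum>k\<le>simplex_dim \<tau>. h (sorted_list_of_set \<tau> ! k)) = (\<Sum>v\<in>\<tau>. h v)"
proof -
  have "bij_betw ((!) (sorted_list_of_set \<tau>)) {..simplex_dim \<tau>} \<tau>"
    using assms length_sorted_simplex[OF assms] by (intro bij_betw_nth) auto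
  then show ?thesis by (rule sum.reindex_bij_betw)
qed

lemma sorted_simplex_nth_mem:
  assumes "finite \<tau>" "\<tau> \<noteq> {}" "k \<le> simplex_dim \<tau>"
  shows "sorted_list_of_set \<tau> ! k \<in> \<tau>"
  using assms length_sorted_simplex[OF assms(1,2)]
  by (metis le_imp_less_Suc nth_mem set_sorted_list_of_set)

lemma sorted_simplex_nth_inject:
  assumes "finite \<tau>" "\<tau> \<noteq> {}" "i \<le> simplex_dim \<tau>" "k \<le> simplex_dim \<tau>"
  shows "sorted_list_of_set \<tau> ! i = sorted_list_of_set \<tau> ! k \<longleftrightarrow> i = k"
  using assms length_sorted_simplex[OF assms(1,2)]
  by (simp add: nth_eq_iff_index_eq)

lemma sorted_simplex_nth_exists:
  assumes "finite \<tau>" "v \<in> \<tau>"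
  obtains k where "k \<le> simplex_dim \<tau>" "v = sorted_list_of_set \<tau> ! k"
proof -
  have "\<tau> \<noteq> {}" using assms by auto
  then show thesis
    using that assms length_sorted_simplex[of \<tau>]
    by (metis in_set_conv_nth less_Suc_eq_le set_sorted_list_of_set)
qed

lemma simplex_point_nth:
  assumes "finite \<tau>" "\<tau> \<noteq> {}"
  shows "simplex_point \<tau> w (sorted_list_of_set \<tau> ! 0) = 1 - (\<Sum>i<simplex_dim \<tau>. w i)"
    and "i < simplex_dim \<tau> \<Longrightarrow> simplex_point \<tau> w (sorted_list_of_set \<tau> ! Suc i) = w i"
proof -
  let ?s = "sorted_list_of_set \<tau>" and ?d = "simplex_dim \<tau>"
  note inj = sorted_simplex_nth_inject[OF assms]
  have "(\<Sum>i = 1..?d. w (i - 1) * (of_bool (?s ! 0 = ?s ! i) - of_bool (?s ! 0 = ?s ! 0))) =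
      (\<Sum>i = 1..?d. - w (i - 1))"
    by (intro sum.cong) (auto simp: inj)
  also have "\<dots> = - (\<Sum>i<?d. w i)"
    by (simp add: sum_negf sum.atLeast1_atMost_eq)
  finally show "simplex_point \<tau> w (?s ! 0) = 1 - (\<Sum>i<?d. w i)"
    by (simp add: simplex_point_def Let_def)
  assume i: "i < ?d"
  have "(\<Sum>j = 1..?d. w (j - 1) * (of_bool (?s ! Suc i = ?s ! j) - of_bool (?s ! Suc i = ?s ! 0))) =
      (\<Sum>j = 1..?d. if j = Suc i then w i else 0)"
    using i by (intro sum.cong) (auto simp: inj)
  then show "simplex_point \<tau> w (?s ! Suc i) = w i"
    using i by (simp add: simplex_point_def Let_def inj)
qed

lemma simplex_point_outside:
  assumes "finite \<tau>" "\<tau> \<noteq> {}" "v \<notin> \<tau>"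
  shows "simplex_point \<tau> w v = 0"
proof -
  have "v \<noteq> sorted_list_of_set \<tau> ! i" if "i \<le> simplex_dim \<tau>" for i
    using sorted_simplex_nth_mem[OF assms(1,2) that] assms(3) by auto
  then show ?thesis by (simp add: simplex_point_def Let_def)
qed

text \<open>The least vertex carries the remaining weight, so the combination is affine in
  \<open>w\<close> and its linear part consists of the edges at that vertex.\<close>

lemma sum_simplex_point_vertices:
  assumes "finite \<tau>" "\<tau> \<noteq> {}"
  shows "(\<Sum>v\<in>\<tau>. simplex_point \<tau> w v * h v) =
    h (sorted_list_of_set \<tau> ! 0) + (\<Sum>i<simplex_dim \<tau>.
      w i * (h (sorted_list_of_set \<tau> ! Suc i) - h (sorted_list_of_set \<tau> ! 0)))"
proof -
  let ?s = "sorted_list_of_set \<tau>" and ?d = "simplex_dim \<tau>"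
  have "(\<Sum>v\<in>\<tau>. simplex_point \<tau> w v * h v) =
      (\<Sum>k\<le>?d. simplex_point \<tau> w (?s ! k) * h (?s ! k))"
    by (rule sum_sorted_simplex[OF assms, symmetric])
  also have "\<dots> = simplex_point \<tau> w (?s ! 0) * h (?s ! 0) +
      (\<Sum>i<?d. simplex_point \<tau> w (?s ! Suc i) * h (?s ! Suc i))"
    by (simp add: sum.atMost_shift)
  also have "\<dots> = (1 - (\<Sum>i<?d. w i)) * h (?s ! 0) + (\<Sum>i<?d. w i * h (?s ! Suc i))"
    using simplex_point_nth[OF assms] by simp
  also have "\<dots> = h (?s ! 0) + (\<Sum>i<?d. w i * (h (?s ! Suc i) - h (?s ! 0)))"
    by (simp add: algebra_simps sum_subtractf sum_distrib_right)
  finally show ?thesis .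
qed

lemma sum_simplex_point:
  assumes "finite \<tau>" "\<tau> \<noteq> {}"
  shows "(\<Sum>v\<in>\<tau>. simplex_point \<tau> w v) = 1"
  using sum_simplex_point_vertices[OF assms, of w "\<lambda>_. 1"] by simp

lemma affine_extension_simplex_point:
  assumes "\<tau> \<subseteq> {..N}" "\<tau> \<noteq> {}"
  shows "affine_extension N h (simplex_point \<tau> w) r = (\<Sum>v\<in>\<tau>. simplex_point \<tau> w v * h v r)"
proof -
  have fin: "finite \<tau>" using assms(1) finite_subset by blast
  show ?thesis unfolding affine_extension_def
    by (rule sum.mono_neutral_right) (use assms fin in \<open>auto simp: simplex_point_outside\<close>)
qed

definition deformed_vertex ::
  "(nat \<Rightarrow> nat \<Rightarrow> real) \<Rightarrow> (nat \<Rightarrow> nat \<Rightarrow> real) \<Rightarrow> real \<Rightarrow> nat \<Rightarrow> nat \<Rightarrow> real" where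
  "deformed_vertex f g t v r = t * f v r + (1 - t) * g v r"

lemma prism_surface_eq:
  assumes "\<tau> \<subseteq> {..N}" "\<tau> \<noteq> {}"
  shows "prism_surface m N f g \<tau> w r =
    (if r < m then \<Sum>v\<in>\<tau>. simplex_point \<tau> w v * deformed_vertex f g (w (simplex_dim \<tau>)) v r
     else if r = m then w (simplex_dim \<tau>) else 0)"
  by (simp add: prism_surface_def deformation_map_def affine_extension_simplex_point[OF assms]
      deformed_vertex_def sum_distrib_left sum.distrib[symmetric] algebra_simps)

text \<open>The surface is affine in the simplex parameters for fixed time and affine in time for
  fixed simplex parameters. Coordinate \<open>m\<close> is the time itself, so its only nonzero
  derivative is the last one.\<close>

lemma partial_deriv_prism_surface:
  fixes \<tau> defines "d \<equiv> simplex_dim \<tau>" and "s \<equiv> sorted_list_of_set \<tau>"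
  assumes "\<tau> \<subseteq> {..N}" "\<tau> \<noteq> {}" "j \<le> d" "r \<le> m"
  shows "partial_deriv (prism_surface m N f g \<tau>) \<alpha> j r =
    (if r = m then of_bool (j = d)
     else if j < d then deformed_vertex f g (\<alpha> d) (s ! Suc j) r - deformed_vertex f g (\<alpha> d) (s ! 0) r
     else \<Sum>v\<in>\<tau>. simplex_point \<tau> \<alpha> v * (f v r - g v r))"
proof -
  have fin: "finite \<tau>" using assms(3) finite_subset by blast
  let ?P = "\<lambda>z. prism_surface m N f g \<tau> (\<alpha>(j := z)) r"
  have eq: "?P z = (if r < m then
      deformed_vertex f g ((\<alpha>(j := z)) d) (s ! 0) r +
      (\<Sum>i<d. (\<alpha>(j := z)) i * (deformed_vertex f g ((\<alpha>(j := z)) d) (s ! Suc i) r -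
          deformed_vertex f g ((\<alpha>(j := z)) d) (s ! 0) r))
      else (\<alpha>(j := z)) d)" for z
    using assms(6) unfolding prism_surface_eq[OF assms(3,4)] d_def s_def
    by (auto simp: sum_simplex_point_vertices[OF fin assms(4)] simp del: fun_upd_apply)
  consider "r = m" | "r < m" "j < d" | "r < m" "j = d" using assms(5,6) by linarith
  then show ?thesis
  proof cases
    case 1
    then have P: "?P = (\<lambda>z. (\<alpha>(j := z)) d)" unfolding eq by simp
    show ?thesis unfolding partial_deriv_def P using 1 by (cases "j = d") auto
  next
    case 2
    let ?c = "\<lambda>i. deformed_vertex f g (\<alpha> d) (s ! Suc i) r - deformed_vertex f g (\<alpha> d) (s ! 0) r"
    have P: "?P = (\<lambda>z. deformed_vertex f g (\<alpha> d) (s ! 0) r +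
        ((\<Sum>i\<in>{..<d} - {j}. \<alpha> i * ?c i) + z * ?c j))"
    proof
      fix z
      have "(\<Sum>i<d. (\<alpha>(j := z)) i * ?c i) = z * ?c j + (\<Sum>i\<in>{..<d} - {j}. \<alpha> i * ?c i)"
        using 2 by (subst sum.remove[of _ j]) (auto intro!: sum.cong)
      then show "?P z = deformed_vertex f g (\<alpha> d) (s ! 0) r +
        ((\<Sum>i\<in>{..<d} - {j}. \<alpha> i * ?c i) + z * ?c j)"
        unfolding eq using 2 by simp
    qed
    have "(?P has_real_derivative ?c j) (at (\<alpha> j))"
      unfolding P by (auto intro!: derivative_eq_intros)
    then show ?thesis unfolding partial_deriv_def using 2 by (simp add: DERIV_imp_deriv)
  next
    case 3
    have P: "?P = (\<lambda>z. deformed_vertex f g z (s ! 0) r +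
        (\<Sum>i<d. \<alpha> i * (deformed_vertex f g z (s ! Suc i) r - deformed_vertex f g z (s ! 0) r)))"
      unfolding eq using 3 by auto
    have "(?P has_real_derivative (f (s ! 0) r - g (s ! 0) r) + (\<Sum>i<d. \<alpha> i *
        ((f (s ! Suc i) r - g (s ! Suc i) r) - (f (s ! 0) r - g (s ! 0) r)))) (at (\<alpha> j))"
      unfolding P deformed_vertex_def
      by (auto intro!: derivative_eq_intros sum.cong simp: algebra_simps)
    then show ?thesis unfolding partial_deriv_def
      using 3 sum_simplex_point_vertices[OF fin assms(4), of \<alpha> "\<lambda>v. f v r - g v r"]
      by (simp add: DERIV_imp_deriv d_def s_def)
  qed
qed

text \<open>The coordinate line through \<alpha> is a continuous map into the space, so an open
  neighbourhood pulls back to an open set of reals. Moves of one coordinate suffice to leave a prism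
  through any of its faces.\<close>

lemma interior_of_Euclidean_space_perturb:
  assumes "\<alpha> \<in> Euclidean_space n interior_of U" "j < n"
  obtains e where "e > 0" "\<And>z. \<bar>z - \<alpha> j\<bar> < e \<Longrightarrow> \<alpha>(j := z) \<in> U"
proof -
  obtain T where T: "openin (Euclidean_space n) T" "\<alpha> \<in> T" "T \<subseteq> U"
    using assms(1) by (auto simp: interior_of_def)
  have \<alpha>: "\<alpha> \<in> topspace (Euclidean_space n)" using T openin_subset by blast
  have "continuous_map euclideanreal (Euclidean_space n) (\<lambda>z. \<alpha>(j := z))"
    unfolding Euclidean_space_def continuous_map_in_subtopology continuous_map_componentwise_UNIV
  proof (intro conjI allI)
    fix k show "continuous_map euclideanreal euclideanreal (\<lambda>z. (\<alpha>(j := z)) k)"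
      by (cases "k = j") auto
  qed (use \<alpha> assms(2) in \<open>auto simp: topspace_Euclidean_space\<close>)
  then have "open {z. \<alpha>(j := z) \<in> T}"
    using T(1) by (auto dest: openin_continuous_map_preimage)
  moreover have "\<alpha> j \<in> {z. \<alpha>(j := z) \<in> T}" using T(2) by simp
  ultimately obtain e where e: "e > 0" "\<And>z. dist z (\<alpha> j) < e \<Longrightarrow> z \<in> {z. \<alpha>(j := z) \<in> T}"
    by (metis open_dist)
  show thesis
  proof (rule that[OF e(1)])
    fix z assume "\<bar>z - \<alpha> j\<bar> < e"
    then show "\<alpha>(j := z) \<in> U" using e(2)[of z] T(3) by (auto simp: dist_real_def)
  qed
qed

text \<open>At an interior point no defining inequality of the prism is an equality, because a small
  move of a single coordinate would violate it.\<close>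

lemma interior_prism_domain:
  assumes "\<alpha> \<in> Euclidean_space (simplex_dim \<tau> + 1) interior_of prism_domain \<tau>"
    and "finite \<tau>" "\<tau> \<noteq> {}"
  shows "0 < \<alpha> (simplex_dim \<tau>)" "\<alpha> (simplex_dim \<tau>) < 1" "\<And>v. v \<in> \<tau> \<Longrightarrow> 0 < simplex_point \<tau> \<alpha> v"
proof -
  let ?d = "simplex_dim \<tau>"
  have dom: "\<alpha> \<in> prism_domain \<tau>" by (rule subsetD[OF interior_of_subset assms(1)])
  obtain e where e: "e > 0" "\<And>z. \<bar>z - \<alpha> ?d\<bar> < e \<Longrightarrow> \<alpha>(?d := z) \<in> prism_domain \<tau>"
    using interior_of_Euclidean_space_perturb[OF assms(1), of ?d] by auto
  show "0 < \<alpha> ?d" "\<alpha> ?d < 1"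
    using e(1) e(2)[of "\<alpha> ?d - e / 2"] e(2)[of "\<alpha> ?d + e / 2"] by (auto simp: prism_domain_def)
  have pos: "0 < \<alpha> i" if i: "i < ?d" for i
  proof -
    obtain e where e: "e > 0" "\<And>z. \<bar>z - \<alpha> i\<bar> < e \<Longrightarrow> \<alpha>(i := z) \<in> prism_domain \<tau>"
      using interior_of_Euclidean_space_perturb[OF assms(1), of i] i by auto
    have "\<alpha>(i := \<alpha> i - e / 2) \<in> prism_domain \<tau>" using e by auto
    then have "0 \<le> (\<alpha>(i := \<alpha> i - e / 2)) i" using i unfolding prism_domain_def by blast
    then show ?thesis using e(1) by simp
  qed
  have less: "(\<Sum>i<?d. \<alpha> i) < 1"
  proof (cases "?d = 0")
    case False
    obtain e where e: "e > 0" "\<And>z. \<bar>z - \<alpha> 0\<bar> < e \<Longrightarrow> \<alpha>(0 := z) \<in> prism_domain \<tau>"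
      using interior_of_Euclidean_space_perturb[OF assms(1), of 0] by auto
    have "\<alpha>(0 := \<alpha> 0 + e / 2) \<in> prism_domain \<tau>" using e by auto
    then have "(\<Sum>i<?d. (\<alpha>(0 := \<alpha> 0 + e / 2)) i) \<le> 1" unfolding prism_domain_def by blast
    moreover have "(\<Sum>i<?d. (\<alpha>(0 := \<alpha> 0 + e / 2)) i) = (\<Sum>i<?d. \<alpha> i + (if i = 0 then e / 2 else 0))"
      by (intro sum.cong) auto
    ultimately show ?thesis using e(1) False by (simp add: sum.distrib)
  \<comment> \<open>In dimension 0 the sum is empty and already below 1.\<close>
  qed simp
  show "0 < simplex_point \<tau> \<alpha> v" if v: "v \<in> \<tau>" for v
  proof -
    obtain k where k: "k \<le> ?d" "v = sorted_list_of_set \<tau> ! k"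
      using sorted_simplex_nth_exists[OF assms(2) v] .
    then show ?thesis
      using less pos simplex_point_nth[OF assms(2,3), where w = \<alpha>] by (cases k) auto
  qed
qed

lemma sum_lessThan_add:
  "(\<Sum>k<a + b. h k) = (\<Sum>k<a. h k) + (\<Sum>k<b. h (a + k :: nat) :: 'a :: comm_monoid_add)"
  by (induction b) (simp_all add: add.assoc)

text \<open>The columns are the vertices of two simplices. Replacing each block by its edges and the
  point with coordinates \<open>x\<close> or \<open>y\<close> multiplies the determinant by
  \<open>(-1) ^ (p + q)\<close>. In the row of ones the edges now have 0 and the two points 1, so
  \<open>matdet_two_unit_row\<close> applies and contributes \<open>(-1) ^ p\<close>.\<close>

lemma matdet_simplex_pair:
  assumes x: "(\<Sum>k\<le>p. x k) = 1" and y: "(\<Sum>k\<le>q. y k) = 1" and m: "m = p + q + 1"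
  shows "matdet (Suc m) (\<lambda>i k. if i = 0 then 1 else c k (i - 1)) = (-1) ^ q *
    matdet m (\<lambda>i k. if Suc k = m then (\<Sum>l\<le>q. y l * c (Suc (p + l)) i) - (\<Sum>l\<le>p. x l * c l i)
       else if k < p then c (Suc k) i - c 0 i else c (Suc (Suc k)) i - c (Suc p) i)"
    (is "matdet _ ?G = _ * matdet _ ?W")
proof -
  define Q where "Q p x k j = (if j < p then of_bool (k = Suc j) - of_bool (k = 0) else x k)"
    for p :: nat and x :: "nat \<Rightarrow> real" and k j :: nat
  let ?B = "\<lambda>i j. if i < Suc p \<and> j < Suc p then Q p x i j
      else if Suc p \<le> i \<and> Suc p \<le> j then Q q y (i - Suc p) (j - Suc p) else 0"
  define E where "E i j = (if j < p then ?G i (Suc j) - ?G i 0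
      else if j = p then \<Sum>l\<le>p. x l * ?G i l
      else if j < m then ?G i (Suc j) - ?G i (Suc p)
      else \<Sum>l\<le>q. y l * ?G i (Suc (p + l)))" for i j
  have size: "Suc m = Suc p + Suc q" using m by simp
  have "matdet (Suc m) ?B = matdet (Suc p) (Q p x) * matdet (Suc q) (Q q y)"
    unfolding size by (rule matdet_block_diagonal)
  also have "\<dots> = (-1) ^ (p + q)"
    using matdet_edge_basis[OF x] matdet_edge_basis[OF y] by (simp add: Q_def[abs_def] power_add)
  finally have detB: "matdet (Suc m) ?B = (-1) ^ (p + q)" .
  have edge: "(\<Sum>k\<le>d. h k * Q d z k j) =
      (if j < d then h (Suc j) - h 0 else \<Sum>k\<le>d. z k * h k)" for d z j and h :: "nat \<Rightarrow> real"
  proof (cases "j < d")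
    case True
    have "(\<Sum>k\<le>d. h k * Q d z k j) =
        (\<Sum>k\<le>d. (if k = Suc j then h k else 0) - (if k = 0 then h k else 0))"
      using True by (intro sum.cong) (auto simp: Q_def)
    then show ?thesis using True by (simp add: sum_subtractf)
  qed (simp add: Q_def mult.commute)
  have "(\<Sum>k<Suc m. ?G i k * ?B k j) = E i j" if "j < Suc m" for i j
  proof -
    have "(\<Sum>k<Suc m. ?G i k * ?B k j) =
        (\<Sum>k<Suc p. ?G i k * ?B k j) + (\<Sum>k<Suc q. ?G i (Suc p + k) * ?B (Suc p + k) j)"
      unfolding size by (rule sum_lessThan_add)
    also have "\<dots> = E i j"
    proof (cases "j < Suc p")
      case True
      then have "(\<Sum>k<Suc p. ?G i k * ?B k j) = (\<Sum>k\<le>p. ?G i k * Q p x k j)"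
        by (intro sum.cong) auto
      moreover have "(\<Sum>k<Suc q. ?G i (Suc p + k) * ?B (Suc p + k) j) = 0"
        using True by (intro sum.neutral) auto
      ultimately show ?thesis using True unfolding edge by (auto simp: E_def)
    next
      case False
      have "(\<Sum>k<Suc q. ?G i (Suc p + k) * ?B (Suc p + k) j) =
          (\<Sum>k\<le>q. ?G i (Suc p + k) * Q q y k (j - Suc p))"
        using False by (intro sum.cong) auto
      moreover have "(\<Sum>k<Suc p. ?G i k * ?B k j) = 0"
        using False by (intro sum.neutral) auto
      moreover have "Suc p + Suc (j - Suc p) = Suc j" using False by simp
      ultimately show ?thesis
        using False that m unfolding edge[of "\<lambda>k. ?G i (Suc p + k)"] by (auto simp: E_def)
    qed
    finally show ?thesis .
  qed
  then have "matdet (Suc m) E = matdet (Suc m) (\<lambda>i j. \<Sum>k<Suc m. ?G i k * ?B k j)"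
    by (intro matdet_cong) simp
  also have "\<dots> = matdet (Suc m) ?G * (-1) ^ (p + q)"
    unfolding matdet_mult detB ..
  finally have 1: "matdet (Suc m) E = matdet (Suc m) ?G * (-1) ^ (p + q)" .
  have "matdet (Suc m) E = (-1) ^ (0 + p) * matdet m (\<lambda>i k.
      if Suc k = m then E (insert_index 0 i) m - E (insert_index 0 i) p
      else E (insert_index 0 i) (insert_index p k))"
    by (rule matdet_two_unit_row) (use m x y in \<open>auto simp: E_def\<close>)
  also have "matdet m (\<lambda>i k.
      if Suc k = m then E (insert_index 0 i) m - E (insert_index 0 i) p
      else E (insert_index 0 i) (insert_index p k)) = matdet m ?W"
    using m by (intro matdet_cong) (auto simp: E_def insert_index_def)
  finally have "matdet (Suc m) ?G * (-1) ^ (p + q) = (-1) ^ p * matdet m ?W" using 1 by simp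
  moreover have "g = (-1) ^ q * w" if "g * (-1) ^ (p + q) = (-1) ^ p * w" for g w :: real
    using that by (cases "even p"; cases "even q") (simp_all add: power_add)
  ultimately show ?thesis by blast
qed

section \<open>Positions in increasing order and the shuffle permutation\<close>

lemma card_less_sorted_nth:
  fixes J :: "nat set"
  assumes "finite J" "k < card J"
  shows "card {j \<in> J. j < sorted_list_of_set J ! k} = k"
proof -
  let ?s = "sorted_list_of_set J"
  have less: "?s ! i < ?s ! k \<longleftrightarrow> i < k" if "i < card J" for i
  proof -
    have "?s ! i < ?s ! k" if "i < k" "k < card J" for i k
      using that sorted_wrt_nth_less[OF strict_sorted_list_of_set, of i k J] by simp
    then show ?thesis using assms(2) that by (metis linorder_neqE_nat order_less_asym)
  qed
  have "{j \<in> J. j < ?s ! k} = (!) ?s ` {..<k}"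
  proof (intro equalityI subsetI)
    fix j assume j: "j \<in> {j \<in> J. j < ?s ! k}"
    then obtain i where "i < card J" "j = ?s ! i"
      using assms(1) by (metis (mono_tags) in_set_conv_nth length_sorted_list_of_set mem_Collect_eq set_sorted_list_of_set)
    then show "j \<in> (!) ?s ` {..<k}" using j less by auto
  next
    fix j assume "j \<in> (!) ?s ` {..<k}"
    then obtain i where i: "i < k" "j = ?s ! i" by auto
    then have "j \<in> J" using assms by (metis length_sorted_list_of_set nth_mem order.strict_trans set_sorted_list_of_set)
    then show "j \<in> {j \<in> J. j < ?s ! k}" using i less assms(2) by simp
  qed
  moreover have "inj_on ((!) ?s) {..<k}"
    using assms(2) by (intro inj_on_nth) auto
  ultimately show ?thesis by (simp add: card_image)
qed

lemma sorted_nth_card_less: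
  fixes J :: "nat set"
  assumes "finite J" "v \<in> J"
  shows "sorted_list_of_set J ! card {j \<in> J. j < v} = v"
proof -
  obtain k where "k < card J" "v = sorted_list_of_set J ! k"
    using assms by (metis in_set_conv_nth length_sorted_list_of_set set_sorted_list_of_set)
  then show ?thesis using card_less_sorted_nth[OF assms(1)] by simp
qed

text \<open>The number of smaller elements is the position in the increasing order, which links
  \<open>shuffle_perm\<close> to the sorted list of the union. Injectivity holds because the
  concatenated list has no repetitions.\<close>

lemma
  assumes "finite \<tau>\<^sub>p" "finite \<tau>\<^sub>m" "\<tau>\<^sub>p \<inter> \<tau>\<^sub>m = {}"
  shows sorted_nth_shuffle_perm: "k < card (\<tau>\<^sub>p \<union> \<tau>\<^sub>m) \<Longrightarrow>
      sorted_list_of_set (\<tau>\<^sub>p \<union> \<tau>\<^sub>m) ! shuffle_perm \<tau>\<^sub>p \<tau>\<^sub>m k =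
      (sorted_list_of_set \<tau>\<^sub>p @ sorted_list_of_set \<tau>\<^sub>m) ! k"
    and shuffle_perm_permutes: "shuffle_perm \<tau>\<^sub>p \<tau>\<^sub>m permutes {..<card (\<tau>\<^sub>p \<union> \<tau>\<^sub>m)}"
proof -
  let ?J = "\<tau>\<^sub>p \<union> \<tau>\<^sub>m" and ?s = "sorted_list_of_set \<tau>\<^sub>p @ sorted_list_of_set \<tau>\<^sub>m"
  have len: "length ?s = card ?J" using assms by (simp add: card_Un_disjoint)
  have mem: "?s ! k \<in> ?J" if "k < card ?J" for k
    using nth_mem[of k ?s] that len assms by auto
  have \<pi>: "shuffle_perm \<tau>\<^sub>p \<tau>\<^sub>m k = (if k < card ?J then card {j \<in> ?J. j < ?s ! k} else k)" for k
    by (simp only: shuffle_perm_def Let_def len)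
  show nth: "sorted_list_of_set ?J ! shuffle_perm \<tau>\<^sub>p \<tau>\<^sub>m k = ?s ! k" if "k < card ?J" for k
    using sorted_nth_card_less[of ?J "?s ! k"] mem[OF that] that assms by (simp add: \<pi>)
  have "inj_on (shuffle_perm \<tau>\<^sub>p \<tau>\<^sub>m) {..<card ?J}"
  proof (rule inj_onI)
    fix i k assume ik: "i \<in> {..<card ?J}" "k \<in> {..<card ?J}"
      and eq: "shuffle_perm \<tau>\<^sub>p \<tau>\<^sub>m i = shuffle_perm \<tau>\<^sub>p \<tau>\<^sub>m k"
    then have "?s ! i = ?s ! k" using nth by (metis lessThan_iff)
    moreover have "distinct ?s" using assms by auto
    ultimately show "i = k" using ik len by (metis lessThan_iff nth_eq_iff_index_eq)
  qed
  moreover have "shuffle_perm \<tau>\<^sub>p \<tau>\<^sub>m ` {..<card ?J} \<subseteq> {..<card ?J}"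
  proof (rule image_subsetI)
    fix k assume k: "k \<in> {..<card ?J}"
    then have "{j \<in> ?J. j < ?s ! k} \<subset> ?J" using mem by blast
    then have "card {j \<in> ?J. j < ?s ! k} < card ?J" using assms by (intro psubset_card_mono) auto
    then show "shuffle_perm \<tau>\<^sub>p \<tau>\<^sub>m k \<in> {..<card ?J}" using k by (simp add: \<pi>)
  qed
  ultimately have "bij_betw (shuffle_perm \<tau>\<^sub>p \<tau>\<^sub>m) {..<card ?J} {..<card ?J}"
    by (simp add: bij_betw_def endo_inj_surj)
  then show "shuffle_perm \<tau>\<^sub>p \<tau>\<^sub>m permutes {..<card ?J}"
    by (rule bij_imp_permutes) (simp add: \<pi>)
qed

text \<open>The parameters are the weights of all vertices except the least; the weight of the least
  one comes out right because the weights sum to 1.\<close>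

lemma simplex_point_surj:
  assumes "finite \<tau>" "\<tau> \<noteq> {}" "(\<Sum>v\<in>\<tau>. x v) = 1" "\<And>v. v \<in> \<tau> \<Longrightarrow> 0 \<le> x v" "t \<in> {0..1}"
  obtains w where "w \<in> prism_domain \<tau>" "w (simplex_dim \<tau>) = t"
    "\<And>v. v \<in> \<tau> \<Longrightarrow> simplex_point \<tau> w v = x v"
proof -
  let ?d = "simplex_dim \<tau>" and ?s = "sorted_list_of_set \<tau>"
  define w where "w i = (if i < ?d then x (?s ! Suc i) else if i = ?d then t else 0)" for i
  note nonneg = assms(4)[OF sorted_simplex_nth_mem[OF assms(1,2)]]
  have "(\<Sum>k\<le>?d. x (?s ! k)) = 1" using sum_sorted_simplex[OF assms(1,2), of x] assms(3) by simp
  then have sum: "x (?s ! 0) + (\<Sum>i<?d. w i) = 1" by (simp add: sum.atMost_shift w_def)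
  then have le: "(\<Sum>i<?d. x (?s ! Suc i)) \<le> 1" using nonneg[of 0] by (simp add: w_def)
  show thesis
  proof (rule that)
    show "w \<in> prism_domain \<tau>"
      using le nonneg assms(5)
      by (auto simp: prism_domain_def topspace_Euclidean_space w_def)
    show "w ?d = t" by (simp add: w_def)
    fix v assume "v \<in> \<tau>"
    then obtain k where "k \<le> ?d" "v = ?s ! k" using sorted_simplex_nth_exists assms(1) by metis
    then show "simplex_point \<tau> w v = x v"
      using simplex_point_nth[OF assms(1,2), where w = w] sum by (cases k) (auto simp: w_def)
  qed
qed

lemma simplex_point_inject:
  assumes "finite \<tau>" "\<tau> \<noteq> {}" "w \<in> prism_domain \<tau>" "w' \<in> prism_domain \<tau>"
    and "w (simplex_dim \<tau>) = w' (simplex_dim \<tau>)"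
    and "\<And>v. v \<in> \<tau> \<Longrightarrow> simplex_point \<tau> w v = simplex_point \<tau> w' v"
  shows "w = w'"
proof
  fix i
  have "w i = w' i" if "i < simplex_dim \<tau>"
    using assms(6)[OF sorted_simplex_nth_mem[OF assms(1,2)], of "Suc i"] that
    by (simp add: simplex_point_nth[OF assms(1,2)])
  moreover have "w i = 0" "w' i = 0" if "i > simplex_dim \<tau>"
    using assms(3,4) that by (auto simp: prism_domain_def topspace_Euclidean_space)
  ultimately show "w i = w' i" using assms(5) by (metis linorder_neqE_nat)
qed

section \<open>The vertex determinant and its derivative at an intersection\<close>

definition deformed_det ::
  "nat \<Rightarrow> (nat \<Rightarrow> nat \<Rightarrow> real) \<Rightarrow> (nat \<Rightarrow> nat \<Rightarrow> real) \<Rightarrow> nat set \<Rightarrow> real \<Rightarrow> real" where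
  "deformed_det m f g J t = matdet (Suc m)
     (\<lambda>i k. if i = 0 then 1 else deformed_vertex f g t (sorted_list_of_set J ! k) (i - 1))"

text \<open>Its sign is the intersection index of the two prisms. The size \<open>Suc m\<close> is
  the sum of their dimensions when the two simplices form an (m-1)-cell.\<close>

definition tangent_det ::
  "nat \<Rightarrow> nat \<Rightarrow> (nat \<Rightarrow> nat \<Rightarrow> real) \<Rightarrow> (nat \<Rightarrow> nat \<Rightarrow> real) \<Rightarrow> nat set \<Rightarrow> nat set \<Rightarrow>
   (nat \<Rightarrow> real) \<Rightarrow> (nat \<Rightarrow> real) \<Rightarrow> real" where
  "tangent_det m N f g \<tau>\<^sub>1 \<tau>\<^sub>2 \<alpha> \<beta> = matdet (Suc m) (\<lambda>r j.
     tangent (simplex_dim \<tau>\<^sub>1 + 1) (prism_surface m N f g \<tau>\<^sub>1) (prism_surface m N f g \<tau>\<^sub>2) \<alpha> \<beta> j r)"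

abbreviation prism_intersections ::
  "nat \<Rightarrow> nat \<Rightarrow> (nat \<Rightarrow> nat \<Rightarrow> real) \<Rightarrow> (nat \<Rightarrow> nat \<Rightarrow> real) \<Rightarrow> nat set \<Rightarrow> nat set \<Rightarrow>
   ((nat \<Rightarrow> real) \<times> (nat \<Rightarrow> real)) set" where
  "prism_intersections m N f g \<tau>\<^sub>1 \<tau>\<^sub>2 \<equiv> intersections
     (prism_domain \<tau>\<^sub>1) (prism_surface m N f g \<tau>\<^sub>1) (prism_domain \<tau>\<^sub>2) (prism_surface m N f g \<tau>\<^sub>2)"

lemma codim_cellsD:
  assumes "(\<tau>\<^sub>1, \<tau>\<^sub>2) \<in> codim_cells m N"
  shows "\<tau>\<^sub>1 \<subseteq> {..N}" "\<tau>\<^sub>1 \<noteq> {}" "finite \<tau>\<^sub>1" "\<tau>\<^sub>2 \<subseteq> {..N}" "\<tau>\<^sub>2 \<noteq> {}" "finite \<tau>\<^sub>2" "\<tau>\<^sub>1 \<inter> \<tau>\<^sub>2 = {}"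
    "m = simplex_dim \<tau>\<^sub>1 + simplex_dim \<tau>\<^sub>2 + 1" "card (\<tau>\<^sub>1 \<union> \<tau>\<^sub>2) = Suc m"
proof -
  show 1: "\<tau>\<^sub>1 \<subseteq> {..N}" "\<tau>\<^sub>1 \<noteq> {}" "\<tau>\<^sub>2 \<subseteq> {..N}" "\<tau>\<^sub>2 \<noteq> {}" "\<tau>\<^sub>1 \<inter> \<tau>\<^sub>2 = {}"
    and m: "m = simplex_dim \<tau>\<^sub>1 + simplex_dim \<tau>\<^sub>2 + 1"
    using assms by (auto simp: codim_cells_def deleted_product_def skeleton_def)
  show fin: "finite \<tau>\<^sub>1" "finite \<tau>\<^sub>2" using 1 finite_subset by blast+
  have "card \<tau>\<^sub>1 > 0" "card \<tau>\<^sub>2 > 0" using 1 fin by (simp_all add: card_gt_0_iff)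
  then show "card (\<tau>\<^sub>1 \<union> \<tau>\<^sub>2) = Suc m"
    using m 1 fin by (simp add: card_Un_disjoint simplex_dim_def)
qed

text \<open>Coordinate \<open>m\<close> of a surface point is its time, so the two prisms meet at
  equal times; the other coordinates equate two convex combinations of vertices deformed to that
  time.\<close>

lemma prism_intersectionsD:
  assumes "(\<tau>\<^sub>1, \<tau>\<^sub>2) \<in> codim_cells m N" "(\<alpha>, \<beta>) \<in> prism_intersections m N f g \<tau>\<^sub>1 \<tau>\<^sub>2"
  shows "\<alpha> \<in> prism_domain \<tau>\<^sub>1" "\<beta> \<in> prism_domain \<tau>\<^sub>2"
    "\<beta> (simplex_dim \<tau>\<^sub>2) = \<alpha> (simplex_dim \<tau>\<^sub>1)"
    "r < m \<Longrightarrow> (\<Sum>v\<in>\<tau>\<^sub>1. simplex_point \<tau>\<^sub>1 \<alpha> v * deformed_vertex f g (\<alpha> (simplex_dim \<tau>\<^sub>1)) v r) =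
      (\<Sum>v\<in>\<tau>\<^sub>2. simplex_point \<tau>\<^sub>2 \<beta> v * deformed_vertex f g (\<alpha> (simplex_dim \<tau>\<^sub>1)) v r)"
proof -
  note cell = codim_cellsD[OF assms(1)]
  show "\<alpha> \<in> prism_domain \<tau>\<^sub>1" "\<beta> \<in> prism_domain \<tau>\<^sub>2"
    using assms(2) by (auto simp: intersections_def)
  have eq: "prism_surface m N f g \<tau>\<^sub>1 \<alpha> r = prism_surface m N f g \<tau>\<^sub>2 \<beta> r" for r
    using assms(2) by (auto simp: intersections_def)
  show time: "\<beta> (simplex_dim \<tau>\<^sub>2) = \<alpha> (simplex_dim \<tau>\<^sub>1)"
    using eq[of m] by (simp add: prism_surface_eq cell)
  show "(\<Sum>v\<in>\<tau>\<^sub>1. simplex_point \<tau>\<^sub>1 \<alpha> v * deformed_vertex f g (\<alpha> (simplex_dim \<tau>\<^sub>1)) v r) =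
      (\<Sum>v\<in>\<tau>\<^sub>2. simplex_point \<tau>\<^sub>2 \<beta> v * deformed_vertex f g (\<alpha> (simplex_dim \<tau>\<^sub>1)) v r)" if "r < m"
    using eq[of r] that by (simp add: prism_surface_eq cell time)
qed

text \<open>
  Let \<open>a\<close>, \<open>b\<close> be the points of the two deformed simplices with the barycentric coordinates of an
  intersection at time \<open>t\<close>. Expressed in the edges of the two simplices together with \<open>a\<close> and \<open>b\<close>,
  the determinant at time \<open>z\<close> has \<open>b - a = (z - t) * w\<close> as a column, where \<open>w\<close> does not depend
  on \<open>z\<close>; the tangent vectors yield the same determinant with column \<open>w\<close>.
\<close>
lemma deformed_det_deriv:
  assumes "(\<tau>\<^sub>1, \<tau>\<^sub>2) \<in> codim_cells m N" "(\<alpha>, \<beta>) \<in> prism_intersections m N f g \<tau>\<^sub>1 \<tau>\<^sub>2"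
  shows "deformed_det m f g (\<tau>\<^sub>1 \<union> \<tau>\<^sub>2) (\<alpha> (simplex_dim \<tau>\<^sub>1)) = 0"
    and "(deformed_det m f g (\<tau>\<^sub>1 \<union> \<tau>\<^sub>2) has_real_derivative
       - of_int (shuffle_sign (\<tau>\<^sub>1, \<tau>\<^sub>2)) * tangent_det m N f g \<tau>\<^sub>1 \<tau>\<^sub>2 \<alpha> \<beta>) (at (\<alpha> (simplex_dim \<tau>\<^sub>1)))"
proof -
  note cell = codim_cellsD[OF assms(1)] and isect = prism_intersectionsD[OF assms]
  define p q where "p = simplex_dim \<tau>\<^sub>1" and "q = simplex_dim \<tau>\<^sub>2"
  define t where "t = \<alpha> p"
  let ?s = "sorted_list_of_set \<tau>\<^sub>1" and ?s' = "sorted_list_of_set \<tau>\<^sub>2"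
  let ?sgn = "real_of_int (shuffle_sign (\<tau>\<^sub>1, \<tau>\<^sub>2))"
  define \<sigma> where "\<sigma> k = (?s @ ?s') ! k" for k
  define c where "c z k i = deformed_vertex f g z (\<sigma> k) i" for z k i
  have m: "m = p + q + 1" using cell by (simp add: p_def q_def)
  have len: "length ?s = Suc p" "length ?s' = Suc q"
    using length_sorted_simplex cell unfolding p_def q_def by blast+
  have \<sigma>1: "\<sigma> k = ?s ! k" if "k \<le> p" for k using that len by (simp add: \<sigma>_def nth_append)
  have \<sigma>2: "\<sigma> (Suc (p + k)) = ?s' ! k" for k using len by (simp add: \<sigma>_def nth_append)
  let ?x = "simplex_point \<tau>\<^sub>1 \<alpha>" and ?y = "simplex_point \<tau>\<^sub>2 \<beta>"
  have sum1: "(\<Sum>k\<le>p. ?x (?s ! k) * h (\<sigma> k)) = (\<Sum>v\<in>\<tau>\<^sub>1. ?x v * h v)" for h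
    using sum_sorted_simplex[OF cell(3,2), of "\<lambda>v. ?x v * h v"] by (simp add: \<sigma>1 p_def[symmetric])
  have sum2: "(\<Sum>k\<le>q. ?y (?s' ! k) * h (\<sigma> (Suc (p + k)))) = (\<Sum>v\<in>\<tau>\<^sub>2. ?y v * h v)" for h
    using sum_sorted_simplex[OF cell(6,5), of "\<lambda>v. ?y v * h v"] by (simp add: \<sigma>2 q_def[symmetric])
  \<comment> \<open>The velocity of \<open>b - a\<close> while the barycentric coordinates are kept
    fixed.\<close>
  define w where "w i = (\<Sum>v\<in>\<tau>\<^sub>2. ?y v * (f v i - g v i)) - (\<Sum>v\<in>\<tau>\<^sub>1. ?x v * (f v i - g v i))" for i
  define W where "W z i k = (if k = p + q then w i
      else if k < p then c z (Suc k) i - c z 0 i else c z (Suc (Suc k)) i - c z (Suc p) i)" for z i k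
  have x1: "(\<Sum>k\<le>p. ?x (?s ! k)) = 1" using sum1[of "\<lambda>_. 1"] sum_simplex_point cell by simp
  have y1: "(\<Sum>k\<le>q. ?y (?s' ! k)) = 1" using sum2[of "\<lambda>_. 1"] sum_simplex_point cell by simp
  \<comment> \<open>The deformed vertices are affine in \<open>z\<close> and the two points coincide
    at \<open>z = t\<close>, so only the velocity term remains.\<close>
  have move: "(\<Sum>v\<in>\<tau>\<^sub>2. ?y v * deformed_vertex f g z v i) - (\<Sum>v\<in>\<tau>\<^sub>1. ?x v * deformed_vertex f g z v i) =
      (z - t) * w i" if "i < m" for z i
  proof -
    have *: "(\<Sum>v\<in>\<tau>. u v * deformed_vertex f g z v i) = (\<Sum>v\<in>\<tau>. u v * deformed_vertex f g t v i) +
        (z - t) * (\<Sum>v\<in>\<tau>. u v * (f v i - g v i))" for \<tau> u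
      by (simp add: deformed_vertex_def sum_distrib_left sum.distrib[symmetric] algebra_simps)
    show ?thesis using isect(4)[OF that] unfolding *[of _ \<tau>\<^sub>1] *[of _ \<tau>\<^sub>2] w_def
      by (simp add: t_def p_def algebra_simps)
  qed
  have D: "deformed_det m f g (\<tau>\<^sub>1 \<union> \<tau>\<^sub>2) z = ?sgn * (-1) ^ q * matdet m (W z) * (z - t)" for z
  proof -
    let ?a = "\<lambda>i k. if i = 0 then 1
      else deformed_vertex f g z (sorted_list_of_set (\<tau>\<^sub>1 \<union> \<tau>\<^sub>2) ! k) (i - 1)"
    have "matdet (Suc m) (\<lambda>i k. if i = 0 then 1 else c z k (i - 1)) =
        matdet (Suc m) (\<lambda>i k. ?a i (shuffle_perm \<tau>\<^sub>1 \<tau>\<^sub>2 k))"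
      using sorted_nth_shuffle_perm[OF cell(3,6,7)] cell(9)
      by (intro matdet_cong) (simp add: c_def \<sigma>_def)
    also have "\<dots> = ?sgn * deformed_det m f g (\<tau>\<^sub>1 \<union> \<tau>\<^sub>2) z"
      using shuffle_perm_permutes[OF cell(3,6,7)] unfolding cell(9)
      by (subst matdet_permute_columns) (auto simp: shuffle_sign_def deformed_det_def)
    finally have "?sgn * deformed_det m f g (\<tau>\<^sub>1 \<union> \<tau>\<^sub>2) z =
        matdet (Suc m) (\<lambda>i k. if i = 0 then 1 else c z k (i - 1))" by simp
    also have "\<dots> = (-1) ^ q * matdet m (\<lambda>i k. if Suc k = m
        then (\<Sum>l\<le>q. ?y (?s' ! l) * c z (Suc (p + l)) i) - (\<Sum>l\<le>p. ?x (?s ! l) * c z l i)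
        else if k < p then c z (Suc k) i - c z 0 i else c z (Suc (Suc k)) i - c z (Suc p) i)"
      by (rule matdet_simplex_pair) (fact x1 y1 m)+
    also have "matdet m (\<lambda>i k. if Suc k = m
        then (\<Sum>l\<le>q. ?y (?s' ! l) * c z (Suc (p + l)) i) - (\<Sum>l\<le>p. ?x (?s ! l) * c z l i)
        else if k < p then c z (Suc k) i - c z 0 i else c z (Suc (Suc k)) i - c z (Suc p) i) =
        matdet (Suc (p + q)) (\<lambda>i k. if k = p + q then (z - t) * W z i k else W z i k)"
      using m move unfolding c_def
      by (simp, intro matdet_cong) (auto simp: W_def c_def sum1[of "\<lambda>v. deformed_vertex f g z v _"]
          sum2[of "\<lambda>v. deformed_vertex f g z v _"])
    also have "\<dots> = (z - t) * matdet m (W z)" unfolding matdet_scale_last m by simp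
    finally have "?sgn * deformed_det m f g (\<tau>\<^sub>1 \<union> \<tau>\<^sub>2) z = (-1) ^ q * ((z - t) * matdet m (W z))" .
    moreover have "?sgn = 1 \<or> ?sgn = -1" by (simp add: shuffle_sign_def sign_def)
    ultimately show ?thesis by (auto simp: algebra_simps)
  qed
  show "deformed_det m f g (\<tau>\<^sub>1 \<union> \<tau>\<^sub>2) (\<alpha> (simplex_dim \<tau>\<^sub>1)) = 0"
    unfolding D by (simp add: t_def p_def)
  define T where
    "T = tangent (simplex_dim \<tau>\<^sub>1 + 1) (prism_surface m N f g \<tau>\<^sub>1) (prism_surface m N f g \<tau>\<^sub>2) \<alpha> \<beta>"
  have T: "T j r =
      (if r = m then of_bool (j = p \<or> j = m)
       else if j < p then c t (Suc j) r - c t 0 r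
       else if j = p then \<Sum>v\<in>\<tau>\<^sub>1. ?x v * (f v r - g v r)
       else if j < m then c t (Suc j) r - c t (Suc p) r
       else \<Sum>v\<in>\<tau>\<^sub>2. ?y v * (f v r - g v r))" if "j \<le> m" "r \<le> m" for j r
  proof (cases "j \<le> p")
    case True
    then show ?thesis
      using that m unfolding T_def tangent_def p_def[symmetric]
      by (simp add: partial_deriv_prism_surface[OF cell(1,2)] p_def[symmetric] c_def \<sigma>1 t_def)
  next
    case False
    define k where "k = j - Suc p"
    have j: "j = Suc (p + k)" "k \<le> q" using False that m by (auto simp: k_def)
    show ?thesis
      using that m isect(3) unfolding T_def tangent_def p_def[symmetric] j
      using \<sigma>2[of 0] \<sigma>2[of k] \<sigma>2[of "Suc k"] j(2)
      by (auto simp: partial_deriv_prism_surface[OF cell(4,5)] q_def[symmetric] p_def[symmetric] c_def t_def)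
  qed
  have "tangent_det m N f g \<tau>\<^sub>1 \<tau>\<^sub>2 \<alpha> \<beta> = matdet (Suc m) (\<lambda>r j. T j r)"
    by (simp add: tangent_det_def T_def)
  \<comment> \<open>Row \<open>m\<close> holds the time components: 1 in columns \<open>p\<close>
    and \<open>m\<close>, the time derivatives of the two prisms, and 0 elsewhere.\<close>
  also have "\<dots> = (-1) ^ (m + p) * matdet m (\<lambda>i k.
      if Suc k = m then T m (insert_index m i) - T p (insert_index m i)
      else T (insert_index p k) (insert_index m i))"
    by (rule matdet_two_unit_row) (use m in \<open>auto simp: T\<close>)
  also have "matdet m (\<lambda>i k.
      if Suc k = m then T m (insert_index m i) - T p (insert_index m i)
      else T (insert_index p k) (insert_index m i)) = matdet m (W t)"
    using m by (intro matdet_cong) (auto simp: T W_def w_def insert_index_def)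
  \<comment> \<open>Here \<open>m + p = 2 * p + q + 1\<close>. The minus sign that results is the
    one compensated by the minus in \<open>deformation_cochain\<close>.\<close>
  also have "(-1) ^ (m + p) = - ((-1 :: real) ^ q)"
    by (cases "even p"; cases "even q") (simp_all add: m power_add)
  finally have det: "- ?sgn * tangent_det m N f g \<tau>\<^sub>1 \<tau>\<^sub>2 \<alpha> \<beta> = ?sgn * (-1) ^ q * matdet m (W t)"
    by simp
  have "isCont (\<lambda>z. matdet m (W z)) t"
  proof (rule isCont_matdet)
    fix i j show "isCont (\<lambda>z. W z i j) t"
      unfolding W_def c_def deformed_vertex_def
      by (cases "j = p + q"; cases "j < p") (auto intro!: continuous_intros)
  qed
  then have "isCont (\<lambda>z. ?sgn * (-1) ^ q * matdet m (W z)) t" by (intro continuous_intros)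
  then show "(deformed_det m f g (\<tau>\<^sub>1 \<union> \<tau>\<^sub>2) has_real_derivative
       - ?sgn * tangent_det m N f g \<tau>\<^sub>1 \<tau>\<^sub>2 \<alpha> \<beta>) (at (\<alpha> (simplex_dim \<tau>\<^sub>1)))"
    unfolding CARAT_DERIV det p_def[symmetric] t_def[symmetric]
    by (intro exI[of _ "\<lambda>z. ?sgn * (-1) ^ q * matdet m (W z)"]) (simp add: D)
qed

subsection \<open>Affine dependencies and crossing times\<close>

definition affine_dependency ::
  "nat \<Rightarrow> (nat \<Rightarrow> nat \<Rightarrow> real) \<Rightarrow> nat set \<Rightarrow> (nat \<Rightarrow> real) \<Rightarrow> bool" where
  "affine_dependency m h J c \<longleftrightarrow>
     (\<Sum>j\<in>J. c j) = 0 \<and> (\<forall>r<m. (\<Sum>j\<in>J. c j * h j r) = 0)"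

lemma affine_dependency_linear:
  assumes "affine_dependency m h J c" "affine_dependency m h J c'"
  shows "affine_dependency m h J (\<lambda>j. a * c j + b * c' j)"
  using assms unfolding affine_dependency_def
  by (simp add: sum.distrib sum_distrib_left[symmetric] distrib_right mult.assoc)

text \<open>A kernel vector is a dependency: the row of ones makes its entries sum to zero, and the
  other rows are the coordinates.\<close>

lemma det_zero_affine_dependency:
  assumes "finite J" "card J = Suc m"
    and "matdet (Suc m) (\<lambda>i k. if i = 0 then 1 else h (sorted_list_of_set J ! k) (i - 1)) = 0"
  obtains c j where "affine_dependency m h J c" "j \<in> J" "c j \<noteq> 0"
proof -
  let ?s = "sorted_list_of_set J"
  let ?a = "\<lambda>i k. if i = 0 then 1 else h (?s ! k) (i - 1)"
  let ?A = "Matrix.mat (Suc m) (Suc m) (\<lambda>(i, k). ?a i k)"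
  have J: "J \<noteq> {}" "simplex_dim J = m" using assms by (auto simp: simplex_dim_def)
  obtain v where v: "v \<in> carrier_vec (Suc m)" "v \<noteq> 0\<^sub>v (Suc m)" "?A *\<^sub>v v = 0\<^sub>v (Suc m)"
    using assms(3) det_0_iff_vec_prod_zero[of ?A "Suc m"] by (auto simp: matdet_def)
  \<comment> \<open>Counting the smaller elements of \<open>J\<close> recovers the position of a
    vertex, so the kernel vector becomes a function on vertices.\<close>
  define c where "c j = vec_index v (card {i \<in> J. i < j})" for j
  have c: "c (?s ! k) = vec_index v k" if "k \<le> m" for k
    using card_less_sorted_nth[OF assms(1)] that assms(2) by (simp add: c_def)
  have row: "(\<Sum>k\<le>m. ?a i k * vec_index v k) = 0" if "i \<le> m" for i
  proof -
    have "vec_index (?A *\<^sub>v v) i = 0" using v(3) that by simp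
    then show ?thesis using that v(1)
      by (simp add: scalar_prod_def atLeast0LessThan lessThan_Suc_atMost del: sum.lessThan_Suc)
  qed
  have sum: "(\<Sum>j\<in>J. c j * u j) = (\<Sum>k\<le>m. u (?s ! k) * vec_index v k)" for u
    using sum_sorted_simplex[OF assms(1) J(1), of "\<lambda>j. c j * u j"] J(2)
    by (simp add: c mult.commute)
  have "affine_dependency m h J c"
    unfolding affine_dependency_def
  proof (intro conjI allI impI)
    show "(\<Sum>j\<in>J. c j) = 0" using sum[of "\<lambda>_. 1"] row[of 0] by simp
    fix r assume "r < m"
    then show "(\<Sum>j\<in>J. c j * h j r) = 0" using sum[of "\<lambda>j. h j r"] row[of "Suc r"] by simp
  qed
  moreover obtain k where "k \<le> m" "vec_index v k \<noteq> 0"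
    using v(1,2) by (metis carrier_vecD eq_vecI index_zero_vec(1,2) less_Suc_eq_le)
  moreover have "?s ! k \<in> J"
    using sorted_simplex_nth_mem[OF assms(1) J(1)] J(2) \<open>k \<le> m\<close> by simp
  ultimately show thesis using that c by metis
qed

lemma aff_independent_det:
  fixes J :: "nat set"
  assumes "finite J" "card J = Suc m" "aff_independent m J h"
  shows "matdet (Suc m) (\<lambda>i k. if i = 0 then 1 else h (sorted_list_of_set J ! k) (i - 1)) \<noteq> 0"
proof
  assume "matdet (Suc m) (\<lambda>i k. if i = 0 then 1 else h (sorted_list_of_set J ! k) (i - 1)) = 0"
  from det_zero_affine_dependency[OF assms(1,2) this] obtain c j
    where "affine_dependency m h J c" "j \<in> J" "c j \<noteq> 0" .
  then show False
    using assms(3) unfolding aff_independent_def affine_dependency_def by blast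
qed

text \<open>
  Subtracting the column of the least vertex leaves \<open>m\<close> columns, and those of the fixed
  vertices are constant: if any vertex besides the least one is fixed, so is the least one.
\<close>
lemma deformed_det_poly:
  assumes "finite J" "card J = Suc m" "\<And>i. i \<le> k \<Longrightarrow> f i = g i"
  obtains p where "\<And>t. poly p t = deformed_det m f g J t" "degree p \<le> m - fixed_count k J"
proof -
  let ?s = "sorted_list_of_set J"
  \<comment> \<open>\<open>u + t * v\<close> is the column of vertex \<open>j + 1\<close> minus that
    of the least vertex; \<open>v\<close> is its velocity.\<close>
  define u v where "u i j = g (?s ! Suc j) i - g (?s ! 0) i"
    and "v i j = (f (?s ! Suc j) i - g (?s ! Suc j) i) - (f (?s ! 0) i - g (?s ! 0) i)" for i j
  define Z where "Z = {j. j < m \<and> ?s ! Suc j \<le> k}"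
  have len: "length ?s = Suc m" using assms by simp
  have mono: "?s ! i < ?s ! j" if "i < j" "j \<le> m" for i j
    using that len sorted_wrt_nth_less[OF strict_sorted_list_of_set, of i j J] by simp
  have Min: "Min J = ?s ! 0"
  proof (rule Min_eqI)
    fix y assume "y \<in> J"
    then obtain i where "i \<le> m" "y = ?s ! i"
      using assms(1) len by (metis in_set_conv_nth less_Suc_eq_le set_sorted_list_of_set)
    then show "?s ! 0 \<le> y" using mono[of 0 i] by (cases i) auto
  next
    show "?s ! 0 \<in> J" using assms(1) len by (metis nth_mem set_sorted_list_of_set zero_less_Suc)
  qed (use assms in auto)
  have Z: "v i j = 0" if "j < m" "j \<in> Z" for i j
  proof -
    have "?s ! Suc j \<le> k" "?s ! 0 \<le> k" using that mono[of 0 "Suc j"] by (auto simp: Z_def)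
    then show ?thesis by (simp add: v_def assms(3))
  qed
  have "bij_betw (\<lambda>j. ?s ! Suc j) Z ((J - {Min J}) \<inter> {1..k})"
  proof (rule bij_betw_imageI)
    show "inj_on (\<lambda>j. ?s ! Suc j) Z"
      using len by (auto simp: inj_on_def Z_def nth_eq_iff_index_eq)
    show "(\<lambda>j. ?s ! Suc j) ` Z = (J - {Min J}) \<inter> {1..k}"
    proof (intro equalityI subsetI)
      fix x assume "x \<in> (\<lambda>j. ?s ! Suc j) ` Z"
      then obtain j where j: "j < m" "?s ! Suc j \<le> k" "x = ?s ! Suc j" by (auto simp: Z_def)
      have "x \<in> J" using j len assms(1) by (metis Suc_less_eq nth_mem set_sorted_list_of_set)
      then show "x \<in> (J - {Min J}) \<inter> {1..k}" using j mono[of 0 "Suc j"] Min by auto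
    next
      fix x assume x: "x \<in> (J - {Min J}) \<inter> {1..k}"
      then obtain i where i: "i \<le> m" "x = ?s ! i"
        using assms(1) len by (metis DiffD1 IntD1 in_set_conv_nth less_Suc_eq_le set_sorted_list_of_set)
      then obtain j where "i = Suc j" using x Min by (cases i) auto
      then show "x \<in> (\<lambda>j. ?s ! Suc j) ` Z" using x i by (auto simp: Z_def)
    qed
  qed
  then have "card Z = fixed_count k J" by (simp add: bij_betw_same_card fixed_count_def)
  moreover have "card ({..<m} - Z) = m - card Z"
    by (subst card_Diff_subset) (auto simp: Z_def)
  ultimately obtain p where p: "\<And>t. poly p t = matdet m (\<lambda>i j. u i j + t * v i j)"
    "degree p \<le> m - fixed_count k J"
    using matdet_affine_columns_poly[of m Z v u] Z by auto
  have "deformed_det m f g J t = matdet m (\<lambda>i j. u i j + t * v i j)" for t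
  proof -
    let ?a = "\<lambda>i k. if i = 0 then 1 else deformed_vertex f g t (?s ! k) (i - 1)"
    \<comment> \<open>Unit upper triangular; it subtracts column 0 from every other column.\<close>
    let ?e = "\<lambda>k j::nat. if k = j then 1 else if k = 0 then -1 else 0 :: real"
    let ?b = "\<lambda>i j. if j = 0 then ?a i 0 else ?a i j - ?a i 0"
    have e: "matdet (Suc m) ?e = 1" by (subst matdet_upper_triangular) auto
    have "deformed_det m f g J t = matdet (Suc m) (\<lambda>i j. \<Sum>k<Suc m. ?a i k * ?e k j)"
      unfolding matdet_mult e deformed_det_def by simp
    also have "\<dots> = matdet (Suc m) ?b"
    proof (rule matdet_cong)
      fix i j assume j: "j < Suc m"
      have "(\<Sum>k<Suc m. ?a i k * ?e k j) = (\<Sum>k<Suc m. (if k = j then ?a i k else 0) -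
          (if k = 0 then if j = 0 then 0 else ?a i k else 0))"
        by (intro sum.cong) auto
      also have "\<dots> = (\<Sum>k<Suc m. if k = j then ?a i k else 0) -
          (\<Sum>k<Suc m. if k = 0 then if j = 0 then 0 else ?a i k else 0)"
        by (rule sum_subtractf)
      also have "\<dots> = ?b i j" using j by (simp del: sum.lessThan_Suc)
      finally show "(\<Sum>k<Suc m. ?a i k * ?e k j) = ?b i j" .
    qed
    also have "\<dots> = (-1) ^ (0 + 0) * matdet m (\<lambda>i j. ?b (insert_index 0 i) (insert_index 0 j))"
      by (rule matdet_unit_row) auto
    also have "\<dots> = matdet m (\<lambda>i j. u i j + t * v i j)"
      by (simp, intro matdet_cong) (auto simp: u_def v_def deformed_vertex_def insert_index_def algebra_simps)
    finally show ?thesis .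
  qed
  then show thesis using that[of p] p by simp
qed

lemma floor_sgn: "\<lfloor>sgn (x :: real)\<rfloor> = (if 0 < x then 1 else if x < 0 then -1 else 0)"
  by (simp add: sgn_if floor_eq_iff)

lemma floor_neg_one: "\<lfloor>- 1 :: real\<rfloor> = - 1"
  by (simp add: floor_eq_iff)

section \<open>Intersections of the cells belonging to one vertex set\<close>

locale deformed_simplex =
  fixes m N :: nat and f g :: "nat \<Rightarrow> nat \<Rightarrow> real" and J :: "nat set"
  assumes J: "J \<subseteq> {..N}" "card J = Suc m"
    and cochain_defined: "deformation_cochain_defined m N f g"
begin

lemma finite_J: "finite J" and Min_J: "Min J \<in> J"
  using J by (auto intro!: Min_in card_ge_0_finite)

lemma partition_cellsD:
  assumes "(\<tau>\<^sub>1, \<tau>\<^sub>2) \<in> partition_cells m N J"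
  shows "(\<tau>\<^sub>1, \<tau>\<^sub>2) \<in> codim_cells m N" "\<tau>\<^sub>1 \<union> \<tau>\<^sub>2 = J" "Min J \<in> \<tau>\<^sub>1"
  using assms by (auto simp: partition_cells_def)

lemma finite_partition_cells: "finite (partition_cells m N J)"
  by (rule finite_subset[of _ "Pow J \<times> Pow J"]) (auto simp: partition_cells_def finite_J)

text \<open>Interior parameters give the strict inequalities. Writing the unit vectors in terms of
  the spanning tangent vectors yields a right inverse of the tangent matrix, so its determinant is
  nonzero.\<close>

lemma transversal_intersection:
  assumes "(\<tau>\<^sub>1, \<tau>\<^sub>2) \<in> codim_cells m N" "(\<alpha>, \<beta>) \<in> prism_intersections m N f g \<tau>\<^sub>1 \<tau>\<^sub>2"
  shows "\<alpha> (simplex_dim \<tau>\<^sub>1) \<in> {0<..<1}"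
    "\<And>v. v \<in> \<tau>\<^sub>1 \<Longrightarrow> 0 < simplex_point \<tau>\<^sub>1 \<alpha> v" "\<And>v. v \<in> \<tau>\<^sub>2 \<Longrightarrow> 0 < simplex_point \<tau>\<^sub>2 \<beta> v"
    "tangent_det m N f g \<tau>\<^sub>1 \<tau>\<^sub>2 \<alpha> \<beta> \<noteq> 0"
proof -
  note cell = codim_cellsD[OF assms(1)]
  let ?\<phi> = "prism_surface m N f g \<tau>\<^sub>1" and ?\<psi> = "prism_surface m N f g \<tau>\<^sub>2"
  have trans: "transversal_at (simplex_dim \<tau>\<^sub>1 + 1) (prism_domain \<tau>\<^sub>1) ?\<phi>
      (simplex_dim \<tau>\<^sub>2 + 1) (prism_domain \<tau>\<^sub>2) ?\<psi> \<alpha> \<beta>"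
    using cochain_defined assms
    unfolding deformation_cochain_defined_def surfaces_in_general_position_def by blast
  have size: "simplex_dim \<tau>\<^sub>1 + 1 + (simplex_dim \<tau>\<^sub>2 + 1) = Suc m" using cell(8) by simp
  have int: "\<alpha> \<in> Euclidean_space (simplex_dim \<tau>\<^sub>1 + 1) interior_of prism_domain \<tau>\<^sub>1"
      "\<beta> \<in> Euclidean_space (simplex_dim \<tau>\<^sub>2 + 1) interior_of prism_domain \<tau>\<^sub>2"
    and span: "\<forall>y. \<exists>c. \<forall>r<Suc m. y r = (\<Sum>j<Suc m. c j * tangent (simplex_dim \<tau>\<^sub>1 + 1) ?\<phi> ?\<psi> \<alpha> \<beta> j r)"
    using trans unfolding transversal_at_def size by blast+
  show "\<alpha> (simplex_dim \<tau>\<^sub>1) \<in> {0<..<1}"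
    "\<And>v. v \<in> \<tau>\<^sub>1 \<Longrightarrow> 0 < simplex_point \<tau>\<^sub>1 \<alpha> v" "\<And>v. v \<in> \<tau>\<^sub>2 \<Longrightarrow> 0 < simplex_point \<tau>\<^sub>2 \<beta> v"
    using interior_prism_domain[OF int(1) cell(3,2)] interior_prism_domain[OF int(2) cell(6,5)] by auto
  let ?T = "tangent (simplex_dim \<tau>\<^sub>1 + 1) ?\<phi> ?\<psi> \<alpha> \<beta>"
  have "\<forall>i. \<exists>c. \<forall>r<Suc m. of_bool (r = i) = (\<Sum>j<Suc m. c j * ?T j r)"
  proof
    fix i show "\<exists>c. \<forall>r<Suc m. of_bool (r = i) = (\<Sum>j<Suc m. c j * ?T j r)"
      using span by (rule allE[of _ "\<lambda>r. of_bool (r = i)"])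
  qed
  from choice[OF this] obtain c
    where c: "\<forall>i. \<forall>r<Suc m. of_bool (r = i) = (\<Sum>j<Suc m. c i j * ?T j r)" ..
  have "tangent_det m N f g \<tau>\<^sub>1 \<tau>\<^sub>2 \<alpha> \<beta> * matdet (Suc m) (\<lambda>j i. c i j) =
      matdet (Suc m) (\<lambda>r i. \<Sum>j<Suc m. ?T j r * c i j)"
    by (simp only: matdet_mult tangent_det_def)
  also have "\<dots> = matdet (Suc m) (\<lambda>r i. of_bool (r = i))"
  proof (rule matdet_cong)
    fix r i assume "r < Suc m"
    then show "(\<Sum>j<Suc m. ?T j r * c i j) = of_bool (r = i)"
      using c by (simp only: mult.commute)
  qed
  also have "\<dots> = 1" by (subst matdet_upper_triangular) auto
  finally show "tangent_det m N f g \<tau>\<^sub>1 \<tau>\<^sub>2 \<alpha> \<beta> \<noteq> 0" by auto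
qed

text \<open>Two convex combinations of the same point, brought to one side, form a dependency. Since
  transversality makes all weights strictly positive, the cell can be read back from the
  signs.\<close>

lemma intersection_dependency:
  assumes "(\<tau>\<^sub>1, \<tau>\<^sub>2) \<in> partition_cells m N J" "(\<alpha>, \<beta>) \<in> prism_intersections m N f g \<tau>\<^sub>1 \<tau>\<^sub>2"
  defines "c \<equiv> \<lambda>v. simplex_point \<tau>\<^sub>1 \<alpha> v - simplex_point \<tau>\<^sub>2 \<beta> v"
  shows "affine_dependency m (deformed_vertex f g (\<alpha> (simplex_dim \<tau>\<^sub>1))) J c"
    "\<And>v. v \<in> \<tau>\<^sub>1 \<Longrightarrow> c v = simplex_point \<tau>\<^sub>1 \<alpha> v" "\<And>v. v \<in> \<tau>\<^sub>2 \<Longrightarrow> c v = - simplex_point \<tau>\<^sub>2 \<beta> v"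
    "\<tau>\<^sub>1 = {v \<in> J. 0 < c v}" "\<tau>\<^sub>2 = {v \<in> J. c v < 0}"
proof -
  note part = partition_cellsD[OF assms(1)]
  note cell = codim_cellsD[OF part(1)] and isect = prism_intersectionsD[OF part(1) assms(2)]
    and trans = transversal_intersection[OF part(1) assms(2)]
  show c1: "c v = simplex_point \<tau>\<^sub>1 \<alpha> v" if "v \<in> \<tau>\<^sub>1" for v
    using simplex_point_outside[OF cell(6,5)] that cell(7) by (auto simp: c_def)
  show c2: "c v = - simplex_point \<tau>\<^sub>2 \<beta> v" if "v \<in> \<tau>\<^sub>2" for v
    using simplex_point_outside[OF cell(3,2)] that cell(7) by (auto simp: c_def)
  have "0 < c v" if "v \<in> \<tau>\<^sub>1" for v using c1 trans(2) that by simp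
  moreover have "c v < 0" if "v \<in> \<tau>\<^sub>2" for v using c2 trans(3) that by simp
  ultimately show "\<tau>\<^sub>1 = {v \<in> J. 0 < c v}" "\<tau>\<^sub>2 = {v \<in> J. c v < 0}"
    unfolding part(2)[symmetric] by (auto dest: less_asym)
  have split: "(\<Sum>v\<in>J. c v * h v) =
      (\<Sum>v\<in>\<tau>\<^sub>1. simplex_point \<tau>\<^sub>1 \<alpha> v * h v) - (\<Sum>v\<in>\<tau>\<^sub>2. simplex_point \<tau>\<^sub>2 \<beta> v * h v)" for h
    unfolding part(2)[symmetric] using cell
    by (simp add: sum.union_disjoint c1 c2 sum_negf)
  show "affine_dependency m (deformed_vertex f g (\<alpha> (simplex_dim \<tau>\<^sub>1))) J c"
    unfolding affine_dependency_def
    using split[of "\<lambda>_. 1"] sum_simplex_point cell isect(4) by (simp add: split)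
qed

text \<open>Dividing by the total positive mass \<open>s\<close> turns the two sides of the
  dependency into convex combinations of one point. Vanishing coefficients are put into the first
  simplex, because their absence is derived only later, from this construction.\<close>

lemma dependency_intersection:
  assumes "t \<in> {0..1}" and dep: "affine_dependency m (deformed_vertex f g t) J c"
    and "j \<in> J" "c j \<noteq> 0" "0 \<le> c (Min J)"
  obtains \<tau>\<^sub>1 \<tau>\<^sub>2 \<alpha> \<beta> s where "(\<tau>\<^sub>1, \<tau>\<^sub>2) \<in> partition_cells m N J"
    "(\<alpha>, \<beta>) \<in> prism_intersections m N f g \<tau>\<^sub>1 \<tau>\<^sub>2" "\<alpha> (simplex_dim \<tau>\<^sub>1) = t" "0 < s"
    "\<And>v. v \<in> J \<Longrightarrow> simplex_point \<tau>\<^sub>1 \<alpha> v - simplex_point \<tau>\<^sub>2 \<beta> v = c v / s"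
proof -
  define \<tau>\<^sub>1 \<tau>\<^sub>2 where "\<tau>\<^sub>1 = {v \<in> J. 0 \<le> c v}" and "\<tau>\<^sub>2 = {v \<in> J. c v < 0}"
  define s where "s = (\<Sum>v\<in>\<tau>\<^sub>1. c v)"
  have part: "\<tau>\<^sub>1 \<union> \<tau>\<^sub>2 = J" "\<tau>\<^sub>1 \<inter> \<tau>\<^sub>2 = {}" "finite \<tau>\<^sub>1" "finite \<tau>\<^sub>2"
    by (auto simp: \<tau>\<^sub>1_def \<tau>\<^sub>2_def finite_J)
  have split: "(\<Sum>v\<in>J. h v) = (\<Sum>v\<in>\<tau>\<^sub>1. h v) + (\<Sum>v\<in>\<tau>\<^sub>2. h v)" for h :: "nat \<Rightarrow> real"
    unfolding part(1)[symmetric] by (rule sum.union_disjoint[OF part(3,4,2)])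
  have sum2: "(\<Sum>v\<in>\<tau>\<^sub>2. c v) = - s"
    using dep split[of c] by (simp add: affine_dependency_def s_def)
  \<comment> \<open>If the positive mass were 0, so would be the negative mass, and every
    coefficient would vanish.\<close>
  have "s \<noteq> 0"
  proof
    assume "s = 0"
    then have "\<forall>v\<in>\<tau>\<^sub>1. c v = 0" using part(3) unfolding s_def
      by (subst (asm) sum_nonneg_eq_0_iff) (auto simp: \<tau>\<^sub>1_def)
    moreover have "\<forall>v\<in>\<tau>\<^sub>2. - c v = 0" using part(4) sum2 \<open>s = 0\<close>
      by (subst sum_nonneg_eq_0_iff[symmetric]) (auto simp: \<tau>\<^sub>2_def sum_negf)
    ultimately show False using assms(3,4) part(1) by auto
  qed
  moreover have "0 \<le> s" unfolding s_def by (rule sum_nonneg) (simp add: \<tau>\<^sub>1_def)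
  ultimately have s: "0 < s" by simp
  have ne: "\<tau>\<^sub>1 \<noteq> {}" "\<tau>\<^sub>2 \<noteq> {}" using s sum2 by (auto simp: s_def)
  have mem: "(\<tau>\<^sub>1, \<tau>\<^sub>2) \<in> partition_cells m N J"
  proof -
    have "card \<tau>\<^sub>1 + card \<tau>\<^sub>2 = Suc m" using J(2) part card_Un_disjoint by metis
    moreover have "card \<tau>\<^sub>1 > 0" "card \<tau>\<^sub>2 > 0" using ne part by (simp_all add: card_gt_0_iff)
    moreover have "\<tau>\<^sub>1 \<subseteq> {..N}" "\<tau>\<^sub>2 \<subseteq> {..N}" using J(1) part(1) by auto
    moreover have "Min J \<in> \<tau>\<^sub>1" using Min_J assms(5) by (simp add: \<tau>\<^sub>1_def)
    ultimately show ?thesis using ne part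
      by (auto simp: partition_cells_def codim_cells_def deleted_product_def skeleton_def simplex_dim_def)
  qed
  have "(\<Sum>v\<in>\<tau>\<^sub>1. c v / s) = 1" using s by (simp add: sum_divide_distrib[symmetric] s_def)
  then obtain \<alpha> where \<alpha>: "\<alpha> \<in> prism_domain \<tau>\<^sub>1" "\<alpha> (simplex_dim \<tau>\<^sub>1) = t"
    "\<And>v. v \<in> \<tau>\<^sub>1 \<Longrightarrow> simplex_point \<tau>\<^sub>1 \<alpha> v = c v / s"
    using simplex_point_surj[OF part(3) ne(1), of "\<lambda>v. c v / s" t] assms(1) s
    by (auto simp: \<tau>\<^sub>1_def)
  have "(\<Sum>v\<in>\<tau>\<^sub>2. - c v / s) = 1"
    using s sum2 by (simp add: sum_divide_distrib[symmetric] sum_negf)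
  then obtain \<beta> where \<beta>: "\<beta> \<in> prism_domain \<tau>\<^sub>2" "\<beta> (simplex_dim \<tau>\<^sub>2) = t"
    "\<And>v. v \<in> \<tau>\<^sub>2 \<Longrightarrow> simplex_point \<tau>\<^sub>2 \<beta> v = - c v / s"
    using simplex_point_surj[OF part(4) ne(2), of "\<lambda>v. - c v / s" t] assms(1) s
    by (auto simp: \<tau>\<^sub>2_def divide_nonpos_pos)
  have sub: "\<tau>\<^sub>1 \<subseteq> {..N}" "\<tau>\<^sub>2 \<subseteq> {..N}" using J(1) part(1) by auto
  have "prism_surface m N f g \<tau>\<^sub>1 \<alpha> r = prism_surface m N f g \<tau>\<^sub>2 \<beta> r" for r
  proof (cases "r < m")
    case True
    then have "(\<Sum>v\<in>\<tau>\<^sub>1. c v * deformed_vertex f g t v r) = - (\<Sum>v\<in>\<tau>\<^sub>2. c v * deformed_vertex f g t v r)"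
      using dep split[of "\<lambda>v. c v * deformed_vertex f g t v r"] by (simp add: affine_dependency_def)
    then show ?thesis
      using True \<alpha> \<beta> by (simp add: prism_surface_eq sub ne sum_divide_distrib[symmetric] sum_negf)
  qed (use \<alpha> \<beta> in \<open>simp add: prism_surface_eq sub ne\<close>)
  then have isect: "(\<alpha>, \<beta>) \<in> prism_intersections m N f g \<tau>\<^sub>1 \<tau>\<^sub>2"
    using \<alpha> \<beta> by (auto simp: intersections_def)
  show thesis
  proof (rule that[OF mem isect \<alpha>(2) s])
    fix v assume "v \<in> J"
    then show "simplex_point \<tau>\<^sub>1 \<alpha> v - simplex_point \<tau>\<^sub>2 \<beta> v = c v / s"
      using intersection_dependency(2,3)[OF mem isect] \<alpha>(3) \<beta>(3) part(1) by fastforce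
  qed
qed

text \<open>
  A dependency with a vanishing coefficient would give an intersection on the boundary of a
  prism, which transversality excludes.
\<close>
lemma dependency_nonzero:
  assumes "t \<in> {0..1}" and dep: "affine_dependency m (deformed_vertex f g t) J c"
    and "j \<in> J" "c j \<noteq> 0" "v \<in> J"
  shows "c v \<noteq> 0"
proof -
  \<comment> \<open>The sign is chosen so that \<open>Min J\<close> falls into the first simplex, as
    \<open>partition_cells\<close> demands.\<close>
  define c' where "c' v = (if 0 \<le> c (Min J) then 1 else -1) * c v" for v
  have "affine_dependency m (deformed_vertex f g t) J c'"
    using affine_dependency_linear[OF dep dep, of "if 0 \<le> c (Min J) then 1 else -1" 0]
    by (simp add: c'_def[abs_def])
  moreover have "c' j \<noteq> 0" "0 \<le> c' (Min J)" using assms(4) by (auto simp: c'_def)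
  ultimately obtain \<tau>\<^sub>1 \<tau>\<^sub>2 \<alpha> \<beta> s where cell: "(\<tau>\<^sub>1, \<tau>\<^sub>2) \<in> partition_cells m N J"
    and isect: "(\<alpha>, \<beta>) \<in> prism_intersections m N f g \<tau>\<^sub>1 \<tau>\<^sub>2" and "0 < s"
    and eq: "\<And>v. v \<in> J \<Longrightarrow> simplex_point \<tau>\<^sub>1 \<alpha> v - simplex_point \<tau>\<^sub>2 \<beta> v = c' v / s"
    using dependency_intersection[OF assms(1)] assms(3) by metis
  note dep' = intersection_dependency[OF cell isect]
  have "v \<in> \<tau>\<^sub>1 \<or> v \<in> \<tau>\<^sub>2" using partition_cellsD(2)[OF cell] assms(5) by auto
  moreover have "0 < c' v / s" if "v \<in> \<tau>\<^sub>1"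
    using that unfolding eq[OF assms(5), symmetric] by (subst (asm) dep'(4)) simp
  moreover have "c' v / s < 0" if "v \<in> \<tau>\<^sub>2"
    using that unfolding eq[OF assms(5), symmetric] by (subst (asm) dep'(5)) simp
  ultimately have "c' v / s \<noteq> 0" by auto
  then show ?thesis by (auto simp: c'_def)
qed

text \<open>The linear combination that cancels the coefficients at \<open>Min J\<close> is a
  dependency with a zero entry, so by \<open>dependency_nonzero\<close> it vanishes on all of
  \<open>J\<close>.\<close>

lemma dependency_proportional:
  assumes "t \<in> {0..1}" "affine_dependency m (deformed_vertex f g t) J c"
    "affine_dependency m (deformed_vertex f g t) J c'" "v \<in> J"
  shows "c' (Min J) * c v = c (Min J) * c' v"
proof -
  let ?d = "\<lambda>v. c' (Min J) * c v + - c (Min J) * c' v"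
  have "affine_dependency m (deformed_vertex f g t) J ?d"
    by (rule affine_dependency_linear) fact+
  then have "?d v = 0"
    using dependency_nonzero[OF assms(1), of ?d v "Min J"] assms(4) Min_J by auto
  then show ?thesis by simp
qed

text \<open>Only the time of an intersection is kept; by \<open>intersection_unique\<close> it
  determines the cell in \<open>partition_cells m N J\<close> and both parameters.\<close>

definition crossing_times :: "nat set \<times> nat set \<Rightarrow> real set" where
  "crossing_times = (\<lambda>(\<tau>\<^sub>1, \<tau>\<^sub>2).
     (\<lambda>(\<alpha>, \<beta>). \<alpha> (simplex_dim \<tau>\<^sub>1)) ` prism_intersections m N f g \<tau>\<^sub>1 \<tau>\<^sub>2)"

text \<open>The two dependencies at the common time are proportional, with a positive factor because
  both are positive at \<open>Min J\<close>; so their sign patterns, and with them the cells, agree.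
  The coefficients on the first simplex sum to 1 in both, which forces the factor 1.\<close>

lemma intersection_unique:
  assumes "(\<tau>\<^sub>1, \<tau>\<^sub>2) \<in> partition_cells m N J" "(\<alpha>, \<beta>) \<in> prism_intersections m N f g \<tau>\<^sub>1 \<tau>\<^sub>2"
    and "(\<tau>\<^sub>1', \<tau>\<^sub>2') \<in> partition_cells m N J" "(\<alpha>', \<beta>') \<in> prism_intersections m N f g \<tau>\<^sub>1' \<tau>\<^sub>2'"
    and time: "\<alpha> (simplex_dim \<tau>\<^sub>1) = \<alpha>' (simplex_dim \<tau>\<^sub>1')"
  shows "\<tau>\<^sub>1 = \<tau>\<^sub>1' \<and> \<tau>\<^sub>2 = \<tau>\<^sub>2' \<and> \<alpha> = \<alpha>' \<and> \<beta> = \<beta>'"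
proof -
  note part = partition_cellsD[OF assms(1)] and part' = partition_cellsD[OF assms(3)]
  note cell = codim_cellsD[OF part(1)] and cell' = codim_cellsD[OF part'(1)]
  note isect = prism_intersectionsD[OF part(1) assms(2)]
    and isect' = prism_intersectionsD[OF part'(1) assms(4)]
  define c where "c v = simplex_point \<tau>\<^sub>1 \<alpha> v - simplex_point \<tau>\<^sub>2 \<beta> v" for v
  define c' where "c' v = simplex_point \<tau>\<^sub>1' \<alpha>' v - simplex_point \<tau>\<^sub>2' \<beta>' v" for v
  note dep = intersection_dependency[OF assms(1,2), folded c_def]
    and dep' = intersection_dependency[OF assms(3,4), folded c'_def]
  define a where "a = c' (Min J) / c (Min J)"
  have pos: "0 < c (Min J)" "0 < c' (Min J)" using dep(4) dep'(4) part(3) part'(3) by auto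
  then have a: "0 < a" by (simp add: a_def)
  have "\<alpha> (simplex_dim \<tau>\<^sub>1) \<in> {0..1}"
    using transversal_intersection(1)[OF part(1) assms(2)] by auto
  from dependency_proportional[OF this dep(1) dep'(1)[folded time]]
  have c': "c' v = a * c v" if "v \<in> J" for v
    using pos that by (simp add: a_def field_simps)
  have eq: "\<tau>\<^sub>1' = \<tau>\<^sub>1" "\<tau>\<^sub>2' = \<tau>\<^sub>2"
    unfolding dep(4,5) dep'(4,5) using a
    by (auto simp: c' zero_less_mult_iff mult_less_0_iff)
  have "(\<Sum>v\<in>\<tau>\<^sub>1. c' v) = 1" "(\<Sum>v\<in>\<tau>\<^sub>1. c v) = 1"
    using sum_simplex_point[OF cell(3,2)] dep(2) dep'(2) eq by simp_all
  moreover have "(\<Sum>v\<in>\<tau>\<^sub>1. c' v) = a * (\<Sum>v\<in>\<tau>\<^sub>1. c v)"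
    unfolding sum_distrib_left using part(2) by (intro sum.cong) (auto simp: c')
  ultimately have "a = 1" by simp
  then have cc: "c' v = c v" if "v \<in> J" for v using c' that by simp
  have "\<alpha> = \<alpha>'"
  proof (rule simplex_point_inject[OF cell(3,2) isect(1)])
    fix v assume "v \<in> \<tau>\<^sub>1"
    then show "simplex_point \<tau>\<^sub>1 \<alpha> v = simplex_point \<tau>\<^sub>1 \<alpha>' v"
      using dep(2)[of v] dep'(2)[of v] cc[of v] part(2) by (auto simp: eq)
  qed (use isect'(1) time eq in auto)
  moreover have "\<beta> = \<beta>'"
  proof (rule simplex_point_inject[OF cell(6,5) isect(2)])
    fix v assume "v \<in> \<tau>\<^sub>2"
    then show "simplex_point \<tau>\<^sub>2 \<beta> v = simplex_point \<tau>\<^sub>2 \<beta>' v"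
      using dep(3)[of v] dep'(3)[of v] cc[of v] part(2) by (auto simp: eq)
  qed (use isect'(2,3) isect(3) time eq in auto)
  ultimately show ?thesis using eq by simp
qed

lemma crossing_times_disjoint:
  assumes "c \<in> partition_cells m N J" "c' \<in> partition_cells m N J" "c \<noteq> c'"
  shows "crossing_times c \<inter> crossing_times c' = {}"
proof (rule ccontr)
  obtain \<tau>\<^sub>1 \<tau>\<^sub>2 \<tau>\<^sub>1' \<tau>\<^sub>2' where c: "c = (\<tau>\<^sub>1, \<tau>\<^sub>2)" "c' = (\<tau>\<^sub>1', \<tau>\<^sub>2')" by fastforce
  assume "crossing_times c \<inter> crossing_times c' \<noteq> {}"
  then obtain \<alpha> \<beta> \<alpha>' \<beta>' where "(\<alpha>, \<beta>) \<in> prism_intersections m N f g \<tau>\<^sub>1 \<tau>\<^sub>2"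
    "(\<alpha>', \<beta>') \<in> prism_intersections m N f g \<tau>\<^sub>1' \<tau>\<^sub>2'" "\<alpha> (simplex_dim \<tau>\<^sub>1) = \<alpha>' (simplex_dim \<tau>\<^sub>1')"
    unfolding crossing_times_def c by auto
  then show False using intersection_unique assms c by metis
qed

lemma Union_crossing_times:
  "(\<Union>c\<in>partition_cells m N J. crossing_times c) = {t \<in> {0<..<1}. deformed_det m f g J t = 0}"
proof (intro equalityI subsetI)
  fix t assume "t \<in> (\<Union>c\<in>partition_cells m N J. crossing_times c)"
  then obtain \<tau>\<^sub>1 \<tau>\<^sub>2 \<alpha> \<beta> where cell: "(\<tau>\<^sub>1, \<tau>\<^sub>2) \<in> partition_cells m N J"
    and isect: "(\<alpha>, \<beta>) \<in> prism_intersections m N f g \<tau>\<^sub>1 \<tau>\<^sub>2" and t: "t = \<alpha> (simplex_dim \<tau>\<^sub>1)"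
    by (auto simp: crossing_times_def)
  note part = partition_cellsD[OF cell]
  show "t \<in> {t \<in> {0<..<1}. deformed_det m f g J t = 0}"
    using transversal_intersection(1)[OF part(1) isect] deformed_det_deriv(1)[OF part(1) isect] part(2) t
    by simp
next
  fix t assume t: "t \<in> {t \<in> {0<..<1}. deformed_det m f g J t = 0}"
  then have "matdet (Suc m) (\<lambda>i k. if i = 0 then 1
      else deformed_vertex f g t (sorted_list_of_set J ! k) (i - 1)) = 0"
    by (simp add: deformed_det_def)
  from det_zero_affine_dependency[OF finite_J J(2) this]
  obtain c j where c: "affine_dependency m (deformed_vertex f g t) J c" "j \<in> J" "c j \<noteq> 0" .
  define c' where "c' v = (if 0 \<le> c (Min J) then 1 else -1) * c v" for v
  have "affine_dependency m (deformed_vertex f g t) J c'"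
    using affine_dependency_linear[OF c(1) c(1), of "if 0 \<le> c (Min J) then 1 else -1" 0]
    by (simp add: c'_def[abs_def])
  moreover have "c' j \<noteq> 0" "0 \<le> c' (Min J)" using c(3) by (auto simp: c'_def)
  moreover have "t \<in> {0..1}" using t by simp
  ultimately obtain \<tau>\<^sub>1 \<tau>\<^sub>2 \<alpha> \<beta> where "(\<tau>\<^sub>1, \<tau>\<^sub>2) \<in> partition_cells m N J"
    "(\<alpha>, \<beta>) \<in> prism_intersections m N f g \<tau>\<^sub>1 \<tau>\<^sub>2" "\<alpha> (simplex_dim \<tau>\<^sub>1) = t"
    using dependency_intersection[of t c' j] c(2) by metis
  then show "t \<in> (\<Union>c\<in>partition_cells m N J. crossing_times c)"
    by (force simp: crossing_times_def)
qed

text \<open>The derivative at a crossing is minus the shuffle sign times the tangent determinant,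
  and this minus cancels the one in \<open>deformation_cochain\<close>. Summing over times is
  legitimate because the intersections of a cell have distinct times.\<close>

lemma signed_cochain_eq:
  assumes "c \<in> partition_cells m N J"
  shows "shuffle_sign c * deformation_cochain m N f g c =
    (\<Sum>t\<in>crossing_times c. \<lfloor>sgn (deriv (deformed_det m f g J) t)\<rfloor>)"
proof -
  obtain \<tau>\<^sub>1 \<tau>\<^sub>2 where c: "c = (\<tau>\<^sub>1, \<tau>\<^sub>2)" by fastforce
  note part = partition_cellsD[OF assms[unfolded c]]
  let ?I = "prism_intersections m N f g \<tau>\<^sub>1 \<tau>\<^sub>2" and ?t = "\<lambda>(\<alpha>, \<beta>). \<alpha> (simplex_dim \<tau>\<^sub>1)"
  let ?\<iota> = "\<lambda>(\<alpha>, \<beta>). intersection_index (simplex_dim \<tau>\<^sub>1 + 1) (prism_surface m N f g \<tau>\<^sub>1)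
      (simplex_dim \<tau>\<^sub>2 + 1) (prism_surface m N f g \<tau>\<^sub>2) \<alpha> \<beta>"
  have inj: "inj_on ?t ?I"
  proof (rule inj_onI)
    fix x y assume xy: "x \<in> ?I" "y \<in> ?I" "?t x = ?t y"
    obtain \<alpha> \<beta> \<alpha>' \<beta>' where "x = (\<alpha>, \<beta>)" "y = (\<alpha>', \<beta>')" by fastforce
    then show "x = y"
      using xy intersection_unique[of \<tau>\<^sub>1 \<tau>\<^sub>2 \<alpha> \<beta> \<tau>\<^sub>1 \<tau>\<^sub>2 \<alpha>' \<beta>'] assms c by simp
  qed
  have "- shuffle_sign c * ?\<iota> x = \<lfloor>sgn (deriv (deformed_det m f g J) (?t x))\<rfloor>" if x: "x \<in> ?I" for x
  proof -
    obtain \<alpha> \<beta> where ab: "x = (\<alpha>, \<beta>)" by fastforce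
    have "?\<iota> x = \<lfloor>sgn (tangent_det m N f g \<tau>\<^sub>1 \<tau>\<^sub>2 \<alpha> \<beta>)\<rfloor>"
      using codim_cellsD(8)[OF part(1)]
      by (simp add: ab intersection_index_def tangent_det_def matdet_def)
    moreover have "deriv (deformed_det m f g J) (?t x) =
        - of_int (shuffle_sign c) * tangent_det m N f g \<tau>\<^sub>1 \<tau>\<^sub>2 \<alpha> \<beta>"
      using deformed_det_deriv(2)[OF part(1) x[unfolded ab]] part(2) by (simp add: ab c DERIV_imp_deriv)
    moreover have "shuffle_sign c = 1 \<or> shuffle_sign c = -1"
      by (simp add: c shuffle_sign_def sign_def)
    ultimately show ?thesis by (auto simp: floor_sgn floor_neg_one)
  qed
  then have "- shuffle_sign c * (\<Sum>x\<in>?I. ?\<iota> x) =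
      (\<Sum>x\<in>?I. \<lfloor>sgn (deriv (deformed_det m f g J) (?t x))\<rfloor>)"
    unfolding sum_distrib_left by (rule sum.cong[OF refl])
  also have "\<dots> = (\<Sum>t\<in>crossing_times c. \<lfloor>sgn (deriv (deformed_det m f g J) t)\<rfloor>)"
    unfolding crossing_times_def c using inj by (simp add: sum.reindex o_def)
  finally show ?thesis
    by (simp add: c deformation_cochain_def intersection_number_def)
qed

text \<open>Every root in the open interval is a crossing, where the derivative is the tangent
  determinant up to sign.\<close>

lemma deformed_det_deriv_nonzero:
  assumes "t \<in> {0<..<1}" "deformed_det m f g J t = 0"
  shows "deriv (deformed_det m f g J) t \<noteq> 0"
proof -
  have "t \<in> (\<Union>c\<in>partition_cells m N J. crossing_times c)"
    unfolding Union_crossing_times using assms by simp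
  then obtain \<tau>\<^sub>1 \<tau>\<^sub>2 \<alpha> \<beta> where cell: "(\<tau>\<^sub>1, \<tau>\<^sub>2) \<in> partition_cells m N J"
    and isect: "(\<alpha>, \<beta>) \<in> prism_intersections m N f g \<tau>\<^sub>1 \<tau>\<^sub>2" and t: "t = \<alpha> (simplex_dim \<tau>\<^sub>1)"
    by (auto simp: crossing_times_def)
  note part = partition_cellsD[OF cell]
  show ?thesis
    using deformed_det_deriv(2)[OF part(1) isect] transversal_intersection(4)[OF part(1) isect] part(2) t
    by (simp add: DERIV_imp_deriv shuffle_sign_def sign_def)
qed

end

section \<open>The three bounds from counting roots\<close>

theorem theorem4p9:
  fixes m N k :: nat and f g :: "nat \<Rightarrow> nat \<Rightarrow> real"
  assumes "general_position_map m N f"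
    and "general_position_map m N g"
    and "k \<le> N"
    and "\<And>i. i \<le> k \<Longrightarrow> f i = g i"
    and "general_position_set m (f ` {..N} \<union> g ` {k+1..N})"
    and "\<And>i j. i \<le> N \<Longrightarrow> j \<le> N \<Longrightarrow> f i = g j \<Longrightarrow> i = j"
    and "deformation_cochain_defined m N f g"
  shows "\<forall>J. J \<subseteq> {..N} \<and> card J = m + 1 \<longrightarrow>
    (\<Sum>c \<in> partition_cells m N J. \<bar>deformation_cochain m N f g c\<bar>) \<le> int m - int (fixed_count k J) \<and>
    - 1 \<le> simplex_orientation m g J *
          (\<Sum>c \<in> partition_cells m N J. shuffle_sign c * deformation_cochain m N f g c) \<and>
    simplex_orientation m g J *
      (\<Sum>c \<in> partition_cells m N J. shuffle_sign c * deformation_cochain m N f g c) \<le> 0 \<and>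
    (\<forall>c \<in> partition_cells m N J.
       - \<lceil>(real m - real (fixed_count k J)) / 2\<rceil>
         \<le> simplex_orientation m g J * shuffle_sign c * deformation_cochain m N f g c \<and>
       simplex_orientation m g J * shuffle_sign c * deformation_cochain m N f g c
         \<le> \<lfloor>(real m - real (fixed_count k J)) / 2\<rfloor>)"
proof (intro allI impI)
  fix J :: "nat set" assume asm: "J \<subseteq> {..N} \<and> card J = m + 1"
  interpret deformed_simplex m N f g J
  proof
    show "J \<subseteq> {..N}" "card J = Suc m" using asm by simp_all
  qed (fact assms(7))
  let ?P = "partition_cells m N J" and ?dc = "deformation_cochain m N f g" and ?\<epsilon> = "simplex_orientation m g J"
  let ?D = "deformed_det m f g J"
  define R where "R = {t \<in> {0<..<1}. ?D t = 0}"
  define e where "e t = \<lfloor>sgn (deriv ?D t)\<rfloor>" for t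
  obtain p where p: "\<And>t. poly p t = ?D t" "degree p \<le> m - fixed_count k J"
    by (rule deformed_det_poly[OF finite_J J(2) assms(4)]) blast+
  have Dp: "?D = poly p" using p(1) by auto
  have D0: "?D 0 = matdet (Suc m) (\<lambda>i k. if i = 0 then 1 else g (sorted_list_of_set J ! k) (i - 1))"
    and D1: "?D 1 = matdet (Suc m) (\<lambda>i k. if i = 0 then 1 else f (sorted_list_of_set J ! k) (i - 1))"
    unfolding deformed_det_def deformed_vertex_def by (simp_all add: if_distrib cong: if_cong)
  have "aff_independent m J g" "aff_independent m J f"
    using assms(1,2) J by (auto simp: general_position_map_def)
  then have nz: "?D 0 \<noteq> 0" "?D 1 \<noteq> 0"
    unfolding D0 D1 using aff_independent_det[OF finite_J J(2)] by blast+
  have \<epsilon>: "?\<epsilon> = \<lfloor>sgn (?D 0)\<rfloor>"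
    by (simp add: simplex_orientation_def D0 matdet_def)
  have "p \<noteq> 0" using nz(1) p(1)[of 0] by auto
  have finR: "finite R" unfolding R_def Dp
    by (rule finite_subset[OF _ poly_roots_finite[OF \<open>p \<noteq> 0\<close>]]) auto
  have "fixed_count k J \<le> m"
  proof -
    have "fixed_count k J \<le> card (J - {Min J})"
      unfolding fixed_count_def by (intro card_mono) (auto simp: finite_J)
    then show ?thesis using J(2) Min_J finite_J by simp
  qed
  have "card R \<le> card {t. poly p t = 0}"
    unfolding R_def Dp by (intro card_mono poly_roots_finite[OF \<open>p \<noteq> 0\<close>]) auto
  then have cardR: "int (card R) \<le> int m - int (fixed_count k J)"
    using card_poly_roots_bound[OF \<open>p \<noteq> 0\<close>] p(2) \<open>fixed_count k J \<le> m\<close> by linarith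
  have e: "e t = 1 \<or> e t = -1" if "t \<in> R" for t
    using deformed_det_deriv_nonzero[of t] that by (auto simp: R_def e_def floor_sgn floor_neg_one)
  have sumR: "2 * (\<Sum>t\<in>R. e t) = \<lfloor>sgn (?D 1)\<rfloor> - ?\<epsilon>"
  proof -
    have of_int_sgn: "real_of_int \<lfloor>sgn x\<rfloor> = sgn x" for x :: real
      by (simp add: floor_sgn sgn_if)
    have "2 * (\<Sum>t | t \<in> {0<..<1} \<and> ?D t = 0. sgn (deriv ?D t)) = sgn (?D 1) - sgn (?D 0)"
    proof (rule sum_sgn_deriv_roots)
      show "(?D has_real_derivative deriv ?D t) (at t)" for t
        unfolding Dp by (metis DERIV_imp_deriv poly_DERIV)
    qed (use nz finR deformed_det_deriv_nonzero in \<open>auto simp: R_def\<close>)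
    then have "real_of_int (2 * (\<Sum>t\<in>R. e t)) = real_of_int (\<lfloor>sgn (?D 1)\<rfloor> - ?\<epsilon>)"
      unfolding R_def e_def \<epsilon> by (simp add: of_int_sgn)
    then show ?thesis by (simp only: of_int_eq_iff)
  qed
  have \<epsilon>1: "?\<epsilon> = 1 \<or> ?\<epsilon> = -1" using nz(1) by (auto simp: \<epsilon> floor_sgn floor_neg_one)
  have "\<lfloor>sgn (?D 1)\<rfloor> = 1 \<or> \<lfloor>sgn (?D 1)\<rfloor> = -1" using nz(2) by (auto simp: floor_sgn floor_neg_one)
  \<comment> \<open>Both signs are 1 or -1, so twice the total is
    \<open>?\<epsilon> * \<lfloor>sgn (?D 1)\<rfloor> - 1\<close>, that is 0 or -2.\<close>
  then have total: "?\<epsilon> * (\<Sum>t\<in>R. e t) = 0 \<or> ?\<epsilon> * (\<Sum>t\<in>R. e t) = -1"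
    using \<epsilon>1 sumR by auto
  have signed: "shuffle_sign c * ?dc c = (\<Sum>t\<in>crossing_times c. e t)" if "c \<in> ?P" for c
    using signed_cochain_eq[OF that] by (simp add: e_def)
  have U: "R = (\<Union>c\<in>?P. crossing_times c)" unfolding R_def Union_crossing_times ..
  have subR: "crossing_times c \<subseteq> R" if "c \<in> ?P" for c using that U by auto
  have finC: "finite (crossing_times c)" if "c \<in> ?P" for c
    using subR[OF that] finR finite_subset by blast
  have sumP: "(\<Sum>c\<in>?P. \<Sum>t\<in>crossing_times c. h t) = (\<Sum>t\<in>R. h t)" for h :: "real \<Rightarrow> int"
    unfolding U by (rule sum.UNION_disjoint[symmetric])
      (use finite_partition_cells finC crossing_times_disjoint in auto)
  have "(\<Sum>c\<in>?P. \<bar>?dc c\<bar>) \<le> (\<Sum>c\<in>?P. \<Sum>t\<in>crossing_times c. 1)"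
  proof (rule sum_mono)
    fix c assume c: "c \<in> ?P"
    have "shuffle_sign c = 1 \<or> shuffle_sign c = -1"
      by (simp add: shuffle_sign_def sign_def split: prod.split)
    then have "\<bar>?dc c\<bar> = \<bar>\<Sum>t\<in>crossing_times c. e t\<bar>" unfolding signed[OF c, symmetric] by auto
    also have "\<dots> \<le> (\<Sum>t\<in>crossing_times c. \<bar>e t\<bar>)" by (rule sum_abs)
    also have "\<dots> \<le> (\<Sum>t\<in>crossing_times c. 1)"
      by (rule sum_mono) (use e subR[OF c] in force)
    finally show "\<bar>?dc c\<bar> \<le> (\<Sum>t\<in>crossing_times c. 1)" .
  qed
  also have "\<dots> = int (card R)" unfolding sumP by simp
  finally have part1: "(\<Sum>c\<in>?P. \<bar>?dc c\<bar>) \<le> int m - int (fixed_count k J)" using cardR by simp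
  have "(\<Sum>c\<in>?P. shuffle_sign c * ?dc c) = (\<Sum>t\<in>R. e t)"
    using signed sumP[of e] by simp
  then have part2: "- 1 \<le> ?\<epsilon> * (\<Sum>c\<in>?P. shuffle_sign c * ?dc c)"
      "?\<epsilon> * (\<Sum>c\<in>?P. shuffle_sign c * ?dc c) \<le> 0"
    using total by auto
  have part3: "- \<lceil>(real m - real (fixed_count k J)) / 2\<rceil> \<le> ?\<epsilon> * shuffle_sign c * ?dc c \<and>
      ?\<epsilon> * shuffle_sign c * ?dc c \<le> \<lfloor>(real m - real (fixed_count k J)) / 2\<rfloor>" if c: "c \<in> ?P" for c
  proof -
    \<comment> \<open>By \<open>total\<close>, \<open>card pos - card neg\<close> is 0 or -1, while
      their sum is at most \<open>m - fixed_count k J\<close>. So twice \<open>card pos\<close> is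
      at most this bound and twice \<open>card neg\<close> exceeds it by at most 1; a single cell
      sees only parts of both sets.\<close>
    define pos neg where "pos = {t \<in> R. ?\<epsilon> * e t = 1}" and "neg = {t \<in> R. ?\<epsilon> * e t = -1}"
    have "t \<in> pos \<union> neg" if "t \<in> R" for t
      using e[OF that] \<epsilon>1 that by (auto simp: pos_def neg_def)
    then have R: "R = pos \<union> neg" "pos \<inter> neg = {}" "finite pos" "finite neg"
      using finR by (auto simp: pos_def neg_def)
    have "?\<epsilon> * (\<Sum>t\<in>R. e t) = (\<Sum>t\<in>pos. ?\<epsilon> * e t) + (\<Sum>t\<in>neg. ?\<epsilon> * e t)"
      unfolding sum_distrib_left by (subst R(1)) (rule sum.union_disjoint[OF R(3,4,2)])
    then have diff: "?\<epsilon> * (\<Sum>t\<in>R. e t) = int (card pos) - int (card neg)"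
      by (simp add: pos_def neg_def)
    have card: "card R = card pos + card neg"
      unfolding R(1) using R by (simp add: card_Un_disjoint)
    have "?\<epsilon> * shuffle_sign c * ?dc c = (\<Sum>t\<in>crossing_times c. ?\<epsilon> * e t)"
      by (simp add: signed[OF c] mult.assoc sum_distrib_left)
    also have "\<dots> = (\<Sum>t\<in>crossing_times c \<inter> pos. ?\<epsilon> * e t) + (\<Sum>t\<in>crossing_times c \<inter> neg. ?\<epsilon> * e t)"
      using subR[OF c] R finC[OF c] by (subst sum.union_disjoint[symmetric]) (auto intro!: sum.cong)
    also have "\<dots> = int (card (crossing_times c \<inter> pos)) - int (card (crossing_times c \<inter> neg))"
      by (simp add: pos_def neg_def)
    finally have eq: "?\<epsilon> * shuffle_sign c * ?dc c =
        int (card (crossing_times c \<inter> pos)) - int (card (crossing_times c \<inter> neg))" .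
    have "card (crossing_times c \<inter> pos) \<le> card pos" "card (crossing_times c \<inter> neg) \<le> card neg"
      using R by (auto intro!: card_mono)
    then have "2 * (?\<epsilon> * shuffle_sign c * ?dc c) \<le> int m - int (fixed_count k J)"
      "- (int m - int (fixed_count k J) + 1) \<le> 2 * (?\<epsilon> * shuffle_sign c * ?dc c)"
      using eq diff total card cardR by linarith+
    moreover have "- \<lceil>(real m - real n) / 2\<rceil> \<le> z \<and> z \<le> \<lfloor>(real m - real n) / 2\<rfloor>"
      if "2 * z \<le> int m - int n" "- (int m - int n + 1) \<le> 2 * z" for z :: int and n :: nat
    proof -
      have "real_of_int (2 * z) \<le> real_of_int (int m - int n)"
        "real_of_int (- (int m - int n + 1)) \<le> real_of_int (2 * z)"
        using that by (simp_all only: of_int_le_iff)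
      \<comment> \<open>The lower bound is shifted to a strict inequality for
        \<open>- z - 1\<close>, since strict comparison with an integer is what carries over to the
        ceiling.\<close>
      then have "real_of_int z \<le> (real m - real n) / 2" "real_of_int (- z - 1) < (real m - real n) / 2"
        by simp_all
      then have "z \<le> \<lfloor>(real m - real n) / 2\<rfloor>" "- z - 1 < \<lceil>(real m - real n) / 2\<rceil>"
        unfolding le_floor_iff less_ceiling_iff .
      then show ?thesis by linarith
    qed
    ultimately show ?thesis by blast
  qed
  show "(\<Sum>c\<in>?P. \<bar>?dc c\<bar>) \<le> int m - int (fixed_count k J) \<and>
    - 1 \<le> ?\<epsilon> * (\<Sum>c\<in>?P. shuffle_sign c * ?dc c) \<and> ?\<epsilon> * (\<Sum>c\<in>?P. shuffle_sign c * ?dc c) \<le> 0 \<and>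
    (\<forall>c\<in>?P. - \<lceil>(real m - real (fixed_count k J)) / 2\<rceil> \<le> ?\<epsilon> * shuffle_sign c * ?dc c \<and>
       ?\<epsilon> * shuffle_sign c * ?dc c \<le> \<lfloor>(real m - real (fixed_count k J)) / 2\<rfloor>)"
    using part1 part2 part3 by blast
qed

end
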